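(* For $a\in\mathbb{D}$, $$\mathbf{r}(C_a)=2(I+C_a)T_{\mathbf{g}_a}^{-1}-I \quad\hbox{and}\quad \mathbf{n}(C_a)=2(I-C_a)T_{\mathbf{g}_a}^{-1}-I,$$ where $T_{\mathbf{g}_a}$ is the Toeplitz operator on $H^2$ with symbol $$\mathbf{g}_a(z)=1+\frac{1-|a|^2}{|1-\bar{a}z|^2}\qquad(|z|=1).$$
   Context: $\mathbb{D}$ is the open unit disk and $H^2=H^2(\mathbb{D})$ the Hardy space. For $a\in\mathbb{D}$, $\varphi_a(z)=\frac{a-z}{1-\bar a z}$ and $C_a:H^2\to H^2$, $C_af=f\circ\varphi_a$, is bounded with $C_a^2=I$. For a bounded operator $T$ on $H^2$ with $T^2=I$: $\mathbf{r}(T)=2P_{N(T-I)}-I$ and $\mathbf{n}(T)=2P_{N(T+I)}-I$, where $P_{\mathcal S}$ denotes the orthogonal projection onto the closed subspace $\mathcal S$ and $N(\cdot)$ the nullspace. For $\psi\in L^\infty$ of the unit circle, the Toeplitz operator is $T_\psi f=P_{H^2}(\psi f)$. *)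

theory Defs
  imports "HOL-Complex_Analysis.Complex_Analysis"
begin

section \<open>The Hardy space of the unit disk\<close>

definition taylor_coeff :: "(complex \<Rightarrow> complex) \<Rightarrow> nat \<Rightarrow> complex" where
  "taylor_coeff f n = (deriv ^^ n) f 0 / fact n"

text \<open>Elements are functions on the disk, represented by their extension by \<open>0\<close> to the
  whole plane, so that equality of elements is equality of functions.\<close>

definition hardy2 :: "(complex \<Rightarrow> complex) set" where
  "hardy2 = {f. f holomorphic_on ball 0 1 \<and> (\<forall>z. z \<notin> ball 0 1 \<longrightarrow> f z = 0) \<and>
                summable (\<lambda>n. (norm (taylor_coeff f n))\<^sup>2)}"

definition hardy_inner :: "(complex \<Rightarrow> complex) \<Rightarrow> (complex \<Rightarrow> complex) \<Rightarrow> complex" where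
  "hardy_inner f g = (\<Sum>n. taylor_coeff f n * cnj (taylor_coeff g n))"

definition hardy_norm :: "(complex \<Rightarrow> complex) \<Rightarrow> real" where
  "hardy_norm f = sqrt (\<Sum>n. (norm (taylor_coeff f n))\<^sup>2)"

section \<open>Operators on the Hardy space\<close>

text \<open>Operators are total functions; only their values on \<^const>\<open>hardy2\<close> matter.\<close>

type_synonym hardy_op = "(complex \<Rightarrow> complex) \<Rightarrow> (complex \<Rightarrow> complex)"

definition bounded_op :: "hardy_op \<Rightarrow> bool" where
  "bounded_op T \<longleftrightarrow>
     (\<forall>f\<in>hardy2. T f \<in> hardy2) \<and>
     (\<forall>f\<in>hardy2. \<forall>g\<in>hardy2. T (\<lambda>z. f z + g z) = (\<lambda>z. T f z + T g z)) \<and>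
     (\<forall>c. \<forall>f\<in>hardy2. T (\<lambda>z. c * f z) = (\<lambda>z. c * T f z)) \<and>
     (\<exists>K. \<forall>f\<in>hardy2. hardy_norm (T f) \<le> K * hardy_norm f)"

definition invertible_op :: "hardy_op \<Rightarrow> bool" where
  "invertible_op T \<longleftrightarrow> bounded_op T \<and>
     (\<exists>S. bounded_op S \<and> (\<forall>f\<in>hardy2. S (T f) = f \<and> T (S f) = f))"

definition inverse_op :: "hardy_op \<Rightarrow> hardy_op" where
  "inverse_op T = the_inv_into hardy2 T"

definition null_space :: "hardy_op \<Rightarrow> (complex \<Rightarrow> complex) set" where
  "null_space T = {f \<in> hardy2. T f = (\<lambda>z. 0)}"

definition orth_proj :: "(complex \<Rightarrow> complex) set \<Rightarrow> hardy_op" where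
  "orth_proj S f = (THE g. g \<in> S \<and> (\<forall>h\<in>S. hardy_inner (\<lambda>z. f z - g z) h = 0))"

definition refl_r :: "hardy_op \<Rightarrow> hardy_op" where
  "refl_r T f = (\<lambda>z. 2 * orth_proj (null_space (\<lambda>g z. T g z - g z)) f z - f z)"

definition refl_n :: "hardy_op \<Rightarrow> hardy_op" where
  "refl_n T f = (\<lambda>z. 2 * orth_proj (null_space (\<lambda>g z. T g z + g z)) f z - f z)"

definition disk_aut :: "complex \<Rightarrow> complex \<Rightarrow> complex" where
  "disk_aut a z = (a - z) / (1 - cnj a * z)"

definition comp_op :: "complex \<Rightarrow> hardy_op" where
  "comp_op a f = (\<lambda>z. if z \<in> ball 0 1 then f (disk_aut a z) else 0)"

section \<open>The circle and Toeplitz operators\<close>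

text \<open>Normalised arc length, as a measure on the plane carried by the unit circle.\<close>

definition circle_measure :: "complex measure" where
  "circle_measure = distr (uniform_measure lborel {0..2 * pi}) borel cis"

definition L2_circle :: "(complex \<Rightarrow> complex) set" where
  "L2_circle = {F \<in> borel_measurable borel. integrable circle_measure (\<lambda>z. (norm (F z))\<^sup>2)}"

definition L2_inner :: "(complex \<Rightarrow> complex) \<Rightarrow> (complex \<Rightarrow> complex) \<Rightarrow> complex" where
  "L2_inner F G = (LINT z|circle_measure. F z * cnj (G z))"

text \<open>\<open>H\<^sup>2\<close> sits inside \<open>L\<^sup>2\<close> of the circle through boundary values, i.e. the limit in
  \<open>L\<^sup>2\<close> of the dilates \<open>z \<mapsto> f (r z)\<close> as \<open>r\<close> increases to \<open>1\<close>. This determines the boundary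
  function up to a null set; \<open>boundary\<close> picks a representative, and it is only ever used
  under an integral.\<close>

definition is_boundary :: "(complex \<Rightarrow> complex) \<Rightarrow> (complex \<Rightarrow> complex) \<Rightarrow> bool" where
  "is_boundary f F \<longleftrightarrow> F \<in> L2_circle \<and>
     ((\<lambda>r::real. LINT z|circle_measure. (norm (f (of_real r * z) - F z))\<^sup>2) \<longlongrightarrow> 0) (at_left 1)"

definition boundary :: "(complex \<Rightarrow> complex) \<Rightarrow> (complex \<Rightarrow> complex)" where
  "boundary f = (SOME F. is_boundary f F)"

text \<open>The orthogonal projection of \<open>L\<^sup>2\<close> onto \<open>H\<^sup>2\<close>, its value being regarded as a function on
  the disk.\<close>

definition szego_proj :: "(complex \<Rightarrow> complex) \<Rightarrow> (complex \<Rightarrow> complex)" where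
  "szego_proj G = (THE h. h \<in> hardy2 \<and>
     (\<forall>k\<in>hardy2. L2_inner (\<lambda>z. G z - boundary h z) (boundary k) = 0))"

text \<open>Meaningful for essentially bounded symbols \<open>\<psi>\<close>, where \<open>\<psi> * boundary f\<close> lies in
  \<^const>\<open>L2_circle\<close>.\<close>

definition toeplitz :: "(complex \<Rightarrow> complex) \<Rightarrow> hardy_op" where
  "toeplitz \<psi> f = szego_proj (\<lambda>z. \<psi> z * boundary f z)"

definition symbol_g :: "complex \<Rightarrow> complex \<Rightarrow> complex" where
  "symbol_g a z = of_real (1 + (1 - (norm a)\<^sup>2) / (norm (1 - cnj a * z))\<^sup>2)"

end

theory Submission
  imports Defs
begin

text \<open>
  Write \<open>C = C\<^sub>a\<close> and let \<open>T\<close> be the Toeplitz operator with symbol \<open>g\<^sub>a\<close>. The symbol is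
  \<open>1 + P\<close> with \<open>P\<close> the Poisson kernel, which is the modulus of the derivative of the automorphism
  \<open>\<phi>\<^sub>a\<close> on the circle. Changing variables gives \<open>\<langle>C f, C k\<rangle> = \<langle>P f, k\<rangle>\<close>, that is, \<open>T = I + C\<^sup>* C\<close>
  (\<open>comp_op_inner\<close>, \<open>toeplitz_symbol_g_inner\<close>). Now let \<open>f = T u\<close> and \<open>e = \<plusminus>1\<close>. Since \<open>C\<close> is an
  involution, \<open>u + e C u\<close> is an eigenvector of \<open>C\<close> for \<open>e\<close>, and \<open>f - (u + e C u) = C\<^sup>* C u - e C u\<close>
  is orthogonal to every such eigenvector. So \<open>u + e C u\<close> is the orthogonal projection of \<open>f\<close>
  onto the eigenspace (\<open>orth_proj_comp_op_eigenspace\<close>), and both formulas follow once \<open>T\<close> is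
  invertible.

  Invertibility avoids any abstract Hilbert space theory. Injectivity, with a bound on the inverse,
  comes from \<open>\<langle>T u, u\<rangle> \<ge> \<parallel>u\<parallel>\<^sup>2\<close>. Surjectivity comes from an explicit factorization \<open>g\<^sub>a = \<bar>q\<bar>\<^sup>2\<close> on
  the circle by a function \<open>q\<close> that is analytic and zero-free on the closed disk; the inverse is then
  multiplication by \<open>1/q\<close> after the Toeplitz operator with symbol \<open>1 / cnj q\<close>
  (\<open>symbol_g_factorization\<close>, \<open>toeplitz_symbol_g_surj\<close>).

  The change of variables is checked on monomials, where both sides reduce to the same power of \<open>a\<close>
  by the mean value property (\<open>disk_aut_monomial_inner\<close>), and is extended by continuity. The
  analytic foundation is the correspondence between Hardy functions and their boundary functions:
  completeness of \<open>L\<^sup>2\<close> of the circle (\<open>L2_complete\<close>), the agreement of limits of Taylor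
  polynomials with limits of dilates (\<open>trace_iff_is_boundary\<close>), and the criterion \<open>trace_limit\<close>,
  which identifies the boundary functions of products and of compositions.
\<close>

section \<open>Arc length and the disk algebra\<close>

text \<open>Spelling out the uniform measure as a density turns integrals over the circle into Lebesgue
  integrals over \<open>[0, 2\<pi>]\<close>.\<close>
lemma circle_measure_eq:
  "circle_measure = distr (density lborel (\<lambda>t. ennreal (indicator {0..2*pi} t / (2*pi)))) borel cis"
proof -
  have "(\<lambda>x. indicator {0..2*pi} x / emeasure lborel {0..2*pi})
      = (\<lambda>t::real. ennreal (indicator {0..2*pi} t / (2*pi)))"
    by (auto simp: fun_eq_iff indicator_def divide_ennreal[symmetric])
  then show ?thesis
    unfolding circle_measure_def uniform_measure_def by simp
qed

lemma sets_circle_measure [simp, measurable_cong]: "sets circle_measure = sets borel"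
  by (simp add: circle_measure_def)

lemma space_circle_measure [simp]: "space circle_measure = UNIV"
  by (simp add: circle_measure_def)

lemma cis_borel [measurable]: "cis \<in> borel_measurable borel"
  by (intro borel_measurable_continuous_onI continuous_on_cis continuous_intros)

lemma cnj_borel [measurable]: "cnj \<in> borel_measurable borel"
  by (intro borel_measurable_continuous_onI continuous_intros)

lemma finite_measure_circle_measure: "finite_measure circle_measure"
proof (rule finite_measureI)
  have "emeasure circle_measure UNIV = emeasure (uniform_measure lborel {0..2*pi}) UNIV"
    unfolding circle_measure_def by (subst emeasure_distr) simp_all
  also have "\<dots> = emeasure lborel {0..2*pi} / emeasure lborel {0..2*pi}"
    by (subst emeasure_uniform_measure) auto
  finally show "emeasure circle_measure (space circle_measure) \<noteq> \<infinity>"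
    by (simp add: ennreal_divide_eq_top_iff)
qed

interpretation circle: finite_measure circle_measure
  by (rule finite_measure_circle_measure)

lemma AE_circle_measure: "AE z in circle_measure. norm z = 1"
  unfolding circle_measure_eq by (subst AE_distr_iff) auto

text \<open>Substituting \<open>z = cis t\<close>, \<open>dz = i z dt\<close>, the normalised arc length integral of \<open>f\<close> is
  \<open>1/(2\<pi>i)\<close> times the contour integral of \<open>f z / z\<close>. This makes Cauchy's integral formula
  available for integrals against \<^const>\<open>circle_measure\<close>.\<close>
lemma circle_integral:
  fixes f :: "complex \<Rightarrow> complex"
  assumes [measurable]: "f \<in> borel_measurable borel"
    and f: "continuous_on (sphere 0 1) f"
    and c: "((\<lambda>z. f z / z) has_contour_integral (2 * pi * \<i> * c)) (circlepath 0 1)"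
  shows "(LINT z|circle_measure. f z) = c"
proof -
  have "((\<lambda>t. \<i> * f (cis t)) has_integral 2 * pi * \<i> * c) {0..2*pi}"
    using c unfolding circlepath_def
    by (subst (asm) has_contour_integral_part_circlepath_iff) (simp_all add: mult.commute)
  from has_integral_mult_right[OF this, of "-\<i>"]
  have "((\<lambda>t. f (cis t)) has_integral 2 * pi * c) {0..2*pi}"
    by (simp add: algebra_simps)
  moreover have "continuous_on {0..2*pi} (\<lambda>t. f (cis t))"
    by (rule continuous_on_compose2[OF f]) (auto intro!: continuous_intros)
  then have "set_integrable lborel {0..2*pi} (\<lambda>t. f (cis t))"
    unfolding set_integrable_def by (intro borel_integrable_compact) auto
  ultimately have "(LINT t:{0..2*pi}|lborel. f (cis t)) = 2 * pi * c"
    using set_borel_integral_eq_integral(2) integral_unique by metis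
  then have *: "(LINT t|lborel. indicator {0..2*pi} t *\<^sub>R f (cis t)) = 2 * pi * c"
    unfolding set_lebesgue_integral_def .
  have "(LINT z|circle_measure. f z)
      = (LINT t|lborel. (1 / (2*pi)) *\<^sub>R (indicator {0..2*pi} t *\<^sub>R f (cis t)))"
    unfolding circle_measure_eq
    by (subst integral_distr, measurable, subst integral_density)
       (auto intro!: Bochner_Integration.integral_cong)
  also have "\<dots> = (1 / (2*pi)) *\<^sub>R (2 * pi * c)"
    by (subst integral_scaleR_right) (use * in simp)
  also have "\<dots> = c" by (simp add: scaleR_conv_of_real)
  finally show ?thesis .
qed

text \<open>Measurability on the whole plane is part of the definition because \<^const>\<open>circle_measure\<close> is a
  Borel measure on the plane, and values outside the closed disk are arbitrary.\<close>
definition disk_algebra :: "(complex \<Rightarrow> complex) set" where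
  "disk_algebra = {p \<in> borel_measurable borel.
     continuous_on (cball 0 1) p \<and> p holomorphic_on ball 0 1}"

lemma disk_algebra_add: "p \<in> disk_algebra \<Longrightarrow> q \<in> disk_algebra \<Longrightarrow> (\<lambda>z. p z + q z) \<in> disk_algebra"
  and disk_algebra_diff: "p \<in> disk_algebra \<Longrightarrow> q \<in> disk_algebra \<Longrightarrow> (\<lambda>z. p z - q z) \<in> disk_algebra"
  and disk_algebra_mult: "p \<in> disk_algebra \<Longrightarrow> q \<in> disk_algebra \<Longrightarrow> (\<lambda>z. p z * q z) \<in> disk_algebra"
  and disk_algebra_const: "(\<lambda>z. c) \<in> disk_algebra"
  and disk_algebra_id: "(\<lambda>z. z) \<in> disk_algebra"
  unfolding disk_algebra_def by (auto intro!: continuous_intros holomorphic_intros)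

lemma disk_algebra_power: "p \<in> disk_algebra \<Longrightarrow> (\<lambda>z. p z ^ n) \<in> disk_algebra"
  by (induction n) (auto intro!: disk_algebra_mult disk_algebra_const)

lemma disk_algebra_sum:
  "(\<And>i. i \<in> I \<Longrightarrow> p i \<in> disk_algebra) \<Longrightarrow> (\<lambda>z. \<Sum>i\<in>I. p i z) \<in> disk_algebra"
  by (induction I rule: infinite_finite_induct) (auto intro!: disk_algebra_add disk_algebra_const)

text \<open>On the circle \<open>cnj z ^ k / z = 1 / z ^ Suc k\<close>, so this is Cauchy's formula for the
  \<open>k\<close>-th derivative at the origin.\<close>
lemma circle_integral_fourier:
  assumes p: "p \<in> disk_algebra"
  shows "(LINT z|circle_measure. p z * cnj z ^ k) = taylor_coeff p k"
proof -
  have [measurable]: "p \<in> borel_measurable borel" and c: "continuous_on (cball 0 1) p"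
    and h: "p holomorphic_on ball 0 1" using p by (auto simp: disk_algebra_def)
  have "((\<lambda>u. p u / (u - 0) ^ Suc k) has_contour_integral
          (2 * pi * \<i> / fact k * (deriv ^^ k) p 0)) (circlepath 0 1)"
    by (rule Cauchy_has_contour_integral_higher_derivative_circlepath[OF c h]) simp
  then have "((\<lambda>u. p u / (u - 0) ^ Suc k) has_contour_integral
          (2 * pi * \<i> * taylor_coeff p k)) (circlepath 0 1)"
    by (simp add: taylor_coeff_def)
  then have "((\<lambda>u. p u * cnj u ^ k / u) has_contour_integral
          (2 * pi * \<i> * taylor_coeff p k)) (circlepath 0 1)"
  proof (rule has_contour_integral_eq)
    fix u :: complex assume "u \<in> path_image (circlepath 0 1)"
    then have "norm u = 1" by simp
    then have u: "u * cnj u = 1" "u \<noteq> 0" by (auto simp: complex_norm_square[symmetric])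
    then have "cnj u = 1 / u" by (simp add: field_simps)
    then show "p u / (u - 0) ^ Suc k = p u * cnj u ^ k / u" by (simp add: power_divide)
  qed
  then show ?thesis
    by (intro circle_integral)
       (auto intro!: continuous_intros continuous_on_subset[OF c])
qed

section \<open>Square-integrable functions on the circle\<close>

text \<open>The squared norm is more convenient than the norm: it is an integral, and the inequality
  \<open>\<bar>x + y\<bar>\<^sup>2 \<le> 2\<bar>x\<bar>\<^sup>2 + 2\<bar>y\<bar>\<^sup>2\<close> replaces the triangle inequality in limit arguments.\<close>
abbreviation L2_sq :: "(complex \<Rightarrow> complex) \<Rightarrow> real" where
  "L2_sq F \<equiv> (LINT z|circle_measure. (norm (F z))\<^sup>2)"

definition L2_tendsto :: "('i \<Rightarrow> complex \<Rightarrow> complex) \<Rightarrow> (complex \<Rightarrow> complex) \<Rightarrow> 'i filter \<Rightarrow> bool" where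
  "L2_tendsto F G A \<longleftrightarrow> ((\<lambda>i. L2_sq (\<lambda>z. F i z - G z)) \<longlongrightarrow> 0) A"

lemma L2_measurable [measurable_dest]: "F \<in> L2_circle \<Longrightarrow> F \<in> borel_measurable borel"
  and L2_sq_integrable: "F \<in> L2_circle \<Longrightarrow> integrable circle_measure (\<lambda>z. (norm (F z))\<^sup>2)"
  by (auto simp: L2_circle_def)

lemma norm_add_sq_le:
  fixes x y :: "'a::real_normed_vector"
  shows "(norm (x + y))\<^sup>2 \<le> 2 * (norm x)\<^sup>2 + 2 * (norm y)\<^sup>2"
proof -
  have "(norm (x + y))\<^sup>2 \<le> (norm x + norm y)\<^sup>2"
    by (intro power_mono norm_triangle_ineq) auto
  also have "\<dots> \<le> 2 * (norm x)\<^sup>2 + 2 * (norm y)\<^sup>2"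
    using sum_squares_bound[of "norm x" "norm y"] by (simp add: power2_sum)
  finally show ?thesis .
qed

lemma L2_add:
  assumes [measurable]: "F \<in> L2_circle" "G \<in> L2_circle"
  shows "(\<lambda>z. F z + G z) \<in> L2_circle"
    and L2_sq_add_le: "L2_sq (\<lambda>z. F z + G z) \<le> 2 * L2_sq F + 2 * L2_sq G"
proof -
  have i: "integrable circle_measure (\<lambda>z. 2 * (norm (F z))\<^sup>2 + 2 * (norm (G z))\<^sup>2)"
    using assms by (intro Bochner_Integration.integrable_add integrable_mult_right L2_sq_integrable)
  then have j: "integrable circle_measure (\<lambda>z. (norm (F z + G z))\<^sup>2)"
    by (rule Bochner_Integration.integrable_bound) (auto simp: norm_add_sq_le)
  then show "(\<lambda>z. F z + G z) \<in> L2_circle" by (simp add: L2_circle_def)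
  have "L2_sq (\<lambda>z. F z + G z) \<le> (LINT z|circle_measure. 2 * (norm (F z))\<^sup>2 + 2 * (norm (G z))\<^sup>2)"
    by (intro integral_mono i j norm_add_sq_le)
  also have "\<dots> = 2 * L2_sq F + 2 * L2_sq G"
    using assms by (subst Bochner_Integration.integral_add) (auto intro!: L2_sq_integrable)
  finally show "L2_sq (\<lambda>z. F z + G z) \<le> 2 * L2_sq F + 2 * L2_sq G" .
qed

text \<open>Only the values of the multiplier on the circle matter, as the measure is carried by it.\<close>
lemma L2_mult_bounded:
  assumes [measurable]: "h \<in> borel_measurable borel" and F[measurable]: "F \<in> L2_circle"
    and h: "\<And>z. norm z = 1 \<Longrightarrow> norm (h z) \<le> K"
  shows "(\<lambda>z. h z * F z) \<in> L2_circle"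
    and L2_sq_mult_le: "L2_sq (\<lambda>z. h z * F z) \<le> K\<^sup>2 * L2_sq F"
proof -
  have i: "integrable circle_measure (\<lambda>z. K\<^sup>2 * (norm (F z))\<^sup>2)"
    using F by (intro integrable_mult_right L2_sq_integrable)
  have ae: "AE z in circle_measure. (norm (h z * F z))\<^sup>2 \<le> K\<^sup>2 * (norm (F z))\<^sup>2"
    using AE_circle_measure
  proof eventually_elim
    case (elim z)
    then show ?case using h[OF elim]
      by (auto simp: norm_mult power_mult_distrib intro!: mult_right_mono power_mono)
  qed
  have j: "integrable circle_measure (\<lambda>z. (norm (h z * F z))\<^sup>2)"
    by (rule Bochner_Integration.integrable_bound[OF i]) (use ae in auto)
  then show "(\<lambda>z. h z * F z) \<in> L2_circle" by (simp add: L2_circle_def)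
  show "L2_sq (\<lambda>z. h z * F z) \<le> K\<^sup>2 * L2_sq F"
    using integral_mono_AE[OF j i ae] by simp
qed

lemma L2_scale:
  assumes "F \<in> L2_circle"
  shows "(\<lambda>z. c * F z) \<in> L2_circle" 
  using L2_mult_bounded(1)[of "\<lambda>_. c" F "norm c"] assms by simp

lemma L2_diff:
  assumes "F \<in> L2_circle" "G \<in> L2_circle"
  shows "(\<lambda>z. F z - G z) \<in> L2_circle"
  using L2_add(1)[OF assms(1) L2_scale[OF assms(2), of "-1"]] by simp

lemma L2_sq_commute: "L2_sq (\<lambda>z. F z - G z) = L2_sq (\<lambda>z. G z - F z)"
  by (simp add: norm_minus_commute)

lemma L2_sq_diff_le:
  assumes "F \<in> L2_circle" "G \<in> L2_circle" "H \<in> L2_circle"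
  shows "L2_sq (\<lambda>z. F z - H z) \<le> 2 * L2_sq (\<lambda>z. F z - G z) + 2 * L2_sq (\<lambda>z. G z - H z)"
  using L2_sq_add_le[OF L2_diff[OF assms(1,2)] L2_diff[OF assms(2,3)]] by simp

lemma L2_sq_nonneg: "0 \<le> L2_sq F"
  by simp

lemma L2_bounded:
  assumes "h \<in> borel_measurable borel" "\<And>z. norm z = 1 \<Longrightarrow> norm (h z) \<le> K"
  shows "h \<in> L2_circle"
proof -
  have "(\<lambda>_. 1) \<in> L2_circle" by (simp add: L2_circle_def)
  from L2_mult_bounded(1)[OF assms(1) this assms(2)] show ?thesis by simp
qed

lemma disk_algebra_bounded:
  assumes "p \<in> disk_algebra"
  obtains K where "\<And>z. norm z \<le> 1 \<Longrightarrow> norm (p z) \<le> K"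
proof -
  have "bounded (p ` cball 0 1)"
    using assms by (intro compact_imp_bounded compact_continuous_image) (auto simp: disk_algebra_def)
  then obtain K where "\<forall>z\<in>cball 0 1. norm (p z) \<le> K" by (auto simp: bounded_iff)
  then show ?thesis by (intro that[of K]) simp
qed

lemma disk_algebra_L2: assumes "p \<in> disk_algebra" shows "p \<in> L2_circle"
proof -
  obtain K where "\<And>z. norm z \<le> 1 \<Longrightarrow> norm (p z) \<le> K" using assms by (rule disk_algebra_bounded) blast
  then show ?thesis using assms by (intro L2_bounded[of p K]) (auto simp: disk_algebra_def)
qed

lemma L2_inner_integrable:
  assumes [measurable]: "F \<in> L2_circle" "G \<in> L2_circle"
  shows "integrable circle_measure (\<lambda>z. F z * cnj (G z))"
proof (rule Bochner_Integration.integrable_bound)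
  show "integrable circle_measure (\<lambda>z. (norm (F z))\<^sup>2 + (norm (G z))\<^sup>2)"
    using assms by (intro Bochner_Integration.integrable_add L2_sq_integrable)
  have "norm (F z) * norm (G z) \<le> (norm (F z))\<^sup>2 + (norm (G z))\<^sup>2" for z
    using sum_squares_bound[of "norm (F z)" "norm (G z)"]
      mult_nonneg_nonneg[of "norm (F z)" "norm (G z)"] norm_ge_zero[of "F z"] norm_ge_zero[of "G z"] by linarith
  then show "AE z in circle_measure. norm (F z * cnj (G z)) \<le> norm ((norm (F z))\<^sup>2 + (norm (G z))\<^sup>2)"
    by (intro AE_I2) (simp add: norm_mult)
qed measurable

lemma L2_inner_add_left:
  "F \<in> L2_circle \<Longrightarrow> G \<in> L2_circle \<Longrightarrow> K \<in> L2_circle \<Longrightarrow>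
    L2_inner (\<lambda>z. F z + G z) K = L2_inner F K + L2_inner G K"
  unfolding L2_inner_def ring_distribs
  by (subst Bochner_Integration.integral_add) (auto intro: L2_inner_integrable)

lemma L2_inner_diff_left:
  "F \<in> L2_circle \<Longrightarrow> G \<in> L2_circle \<Longrightarrow> K \<in> L2_circle \<Longrightarrow>
    L2_inner (\<lambda>z. F z - G z) K = L2_inner F K - L2_inner G K"
  unfolding L2_inner_def ring_distribs
  by (subst Bochner_Integration.integral_diff) (auto intro: L2_inner_integrable)

lemma L2_inner_scale_left: "L2_inner (\<lambda>z. c * F z) K = c * L2_inner F K"
  unfolding L2_inner_def by (simp add: mult.assoc)

lemma L2_inner_commute: "L2_inner F G = cnj (L2_inner G F)"
  unfolding L2_inner_def by (subst Bochner_Integration.integral_cnj [symmetric]) (simp add: mult.commute)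

lemma L2_inner_diff_right:
  "F \<in> L2_circle \<Longrightarrow> G \<in> L2_circle \<Longrightarrow> K \<in> L2_circle \<Longrightarrow>
    L2_inner K (\<lambda>z. F z - G z) = L2_inner K F - L2_inner K G"
  by (subst (1 2 3) L2_inner_commute) (simp add: L2_inner_diff_left)

lemma L2_inner_sum_left:
  "(\<And>i. i \<in> I \<Longrightarrow> F i \<in> L2_circle) \<Longrightarrow> K \<in> L2_circle \<Longrightarrow>
    L2_inner (\<lambda>z. \<Sum>i\<in>I. c i * F i z) K = (\<Sum>i\<in>I. c i * L2_inner (F i) K)"
  unfolding L2_inner_def sum_distrib_right
  by (subst Bochner_Integration.integral_sum)
     (auto simp: mult.assoc intro!: integrable_mult_right L2_inner_integrable)

lemma L2_inner_sum_right:
  "(\<And>i. i \<in> I \<Longrightarrow> F i \<in> L2_circle) \<Longrightarrow> K \<in> L2_circle \<Longrightarrow>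
    L2_inner K (\<lambda>z. \<Sum>i\<in>I. c i * F i z) = (\<Sum>i\<in>I. cnj (c i) * L2_inner K (F i))"
  by (subst L2_inner_commute, subst L2_inner_sum_left) (auto simp: L2_inner_commute[of K])

lemma L2_inner_self: "L2_inner F F = of_real (L2_sq F)"
  unfolding L2_inner_def by (simp add: complex_norm_square[symmetric] del: of_real_power flip: integral_complex_of_real)

lemma L2_Cauchy_Schwarz:
  assumes [measurable]: "F \<in> L2_circle" "G \<in> L2_circle"
  shows "(norm (L2_inner F G))\<^sup>2 \<le> L2_sq F * L2_sq G"
proof -
  have "ennreal ((norm (L2_inner F G))\<^sup>2) = (ennreal (norm (L2_inner F G)))\<^sup>2"
    by (simp add: ennreal_power)
  also have "\<dots> \<le> (\<integral>\<^sup>+z. ennreal (norm (F z)) * ennreal (norm (G z)) \<partial>circle_measure)\<^sup>2"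
    unfolding L2_inner_def
    using integral_norm_bound_ennreal[OF L2_inner_integrable[OF assms]]
    by (intro power_mono) (auto simp: norm_mult ennreal_mult)
  also have "\<dots> \<le> (\<integral>\<^sup>+z. (ennreal (norm (F z)))\<^sup>2 \<partial>circle_measure) *
                    (\<integral>\<^sup>+z. (ennreal (norm (G z)))\<^sup>2 \<partial>circle_measure)"
    by (rule Cauchy_Schwarz_nn_integral) measurable
  also have "\<dots> = ennreal (L2_sq F * L2_sq G)"
    using assms by (simp add: ennreal_power nn_integral_eq_integral L2_sq_integrable ennreal_mult)
  finally show ?thesis by simp
qed

lemma L2_eq_AE:
  assumes "F \<in> L2_circle" "G \<in> L2_circle" "L2_sq (\<lambda>z. F z - G z) = 0"
  shows "AE z in circle_measure. F z = G z"
  using integral_nonneg_eq_0_iff_AE[OF L2_sq_integrable[OF L2_diff[OF assms(1,2)]]] assms(3) by simp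

lemma L2_inner_cong_AE:
  assumes "AE z in circle_measure. F z * cnj (G z) = F' z * cnj (G' z)"
    "F \<in> L2_circle" "G \<in> L2_circle" "F' \<in> L2_circle" "G' \<in> L2_circle"
  shows "L2_inner F G = L2_inner F' G'"
  unfolding L2_inner_def
  by (rule integral_cong_AE)
     (use assms L2_inner_integrable[of F G] L2_inner_integrable[of F' G'] in auto)

lemma L2_tendsto_D: "L2_tendsto F G A \<Longrightarrow> ((\<lambda>i. L2_sq (\<lambda>z. F i z - G z)) \<longlongrightarrow> 0) A"
  by (simp add: L2_tendsto_def)

lemma L2_tendsto_unique:
  assumes "L2_tendsto F G A" "L2_tendsto F H A" "A \<noteq> bot"
    and "\<And>i. F i \<in> L2_circle" "G \<in> L2_circle" "H \<in> L2_circle"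
  shows "AE z in circle_measure. G z = H z"
proof -
  have "L2_sq (\<lambda>z. G z - H z) \<le> 2 * 0 + 2 * 0"
  proof (rule tendsto_lowerbound)
    show "((\<lambda>i. 2 * L2_sq (\<lambda>z. F i z - G z) + 2 * L2_sq (\<lambda>z. F i z - H z)) \<longlongrightarrow> 2 * 0 + 2 * 0) A"
      using assms by (intro tendsto_intros L2_tendsto_D)
    show "\<forall>\<^sub>F i in A. L2_sq (\<lambda>z. G z - H z)
      \<le> 2 * L2_sq (\<lambda>z. F i z - G z) + 2 * L2_sq (\<lambda>z. F i z - H z)"
      by (intro always_eventually allI, subst L2_sq_commute[of "F _" "G"])
         (intro L2_sq_diff_le assms)
  qed fact
  then have "L2_sq (\<lambda>z. G z - H z) = 0" by (intro antisym L2_sq_nonneg) simp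
  then show ?thesis by (rule L2_eq_AE[OF assms(5,6)])
qed

lemma L2_inner_tendsto_left:
  assumes "L2_tendsto F F' A" "\<And>i. F i \<in> L2_circle" "F' \<in> L2_circle" "G \<in> L2_circle"
  shows "((\<lambda>i. L2_inner (F i) G) \<longlongrightarrow> L2_inner F' G) A"
proof -
  have "((\<lambda>i. (norm (L2_inner (F i) G - L2_inner F' G))\<^sup>2) \<longlongrightarrow> 0) A"
  proof (rule tendsto_sandwich[OF _ _ tendsto_const])
    show "\<forall>\<^sub>F i in A. (norm (L2_inner (F i) G - L2_inner F' G))\<^sup>2 \<le> L2_sq (\<lambda>z. F i z - F' z) * L2_sq G"
      using assms
      by (intro always_eventually allI, subst L2_inner_diff_left[symmetric])
         (auto intro!: L2_Cauchy_Schwarz L2_diff)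
    show "((\<lambda>i. L2_sq (\<lambda>z. F i z - F' z) * L2_sq G) \<longlongrightarrow> 0) A"
      by (intro tendsto_mult_left_zero L2_tendsto_D assms)
  qed auto
  then have "((\<lambda>i. sqrt ((norm (L2_inner (F i) G - L2_inner F' G))\<^sup>2)) \<longlongrightarrow> sqrt 0) A"
    by (rule tendsto_real_sqrt)
  then have "((\<lambda>i. norm (L2_inner (F i) G - L2_inner F' G)) \<longlongrightarrow> 0) A"
    by simp
  then show ?thesis using Lim_null tendsto_norm_zero_iff by blast
qed

lemma L2_inner_tendsto:
  assumes F: "L2_tendsto F F' A" "\<And>i. F i \<in> L2_circle" "F' \<in> L2_circle"
    and G: "L2_tendsto G G' A" "\<And>i. G i \<in> L2_circle" "G' \<in> L2_circle"
  shows "((\<lambda>i. L2_inner (F i) (G i)) \<longlongrightarrow> L2_inner F' G') A"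
proof -
  have 1: "((\<lambda>i. L2_inner F' (G i)) \<longlongrightarrow> L2_inner F' G') A"
    using tendsto_cnj[OF L2_inner_tendsto_left[OF G F(3)]] by (simp add: L2_inner_commute[symmetric])
  have "((\<lambda>i. (norm (L2_inner (F i) (G i) - L2_inner F' (G i)))\<^sup>2) \<longlongrightarrow> 0) A"
  proof (rule tendsto_sandwich[OF _ _ tendsto_const])
    show "\<forall>\<^sub>F i in A. (norm (L2_inner (F i) (G i) - L2_inner F' (G i)))\<^sup>2
        \<le> L2_sq (\<lambda>z. F i z - F' z) * (2 * L2_sq (\<lambda>z. G i z - G' z) + 2 * L2_sq G')"
    proof (intro always_eventually allI)
      fix i
      have "(norm (L2_inner (F i) (G i) - L2_inner F' (G i)))\<^sup>2 \<le> L2_sq (\<lambda>z. F i z - F' z) * L2_sq (G i)"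
        using F G by (subst L2_inner_diff_left[symmetric]) (auto intro!: L2_Cauchy_Schwarz L2_diff)
      also have "L2_sq (G i) \<le> 2 * L2_sq (\<lambda>z. G i z - G' z) + 2 * L2_sq G'"
        using L2_sq_add_le[OF L2_diff[OF G(2,3)] G(3), of i] by simp
      finally show "(norm (L2_inner (F i) (G i) - L2_inner F' (G i)))\<^sup>2
        \<le> L2_sq (\<lambda>z. F i z - F' z) * (2 * L2_sq (\<lambda>z. G i z - G' z) + 2 * L2_sq G')"
        by (simp add: mult_left_mono)
    qed
    have "((\<lambda>i. L2_sq (\<lambda>z. F i z - F' z) * (2 * L2_sq (\<lambda>z. G i z - G' z) + 2 * L2_sq G'))
        \<longlongrightarrow> 0 * (2 * 0 + 2 * L2_sq G')) A"
      by (intro tendsto_intros L2_tendsto_D F G)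
    then show "((\<lambda>i. L2_sq (\<lambda>z. F i z - F' z) * (2 * L2_sq (\<lambda>z. G i z - G' z) + 2 * L2_sq G'))
        \<longlongrightarrow> 0) A" by simp
  qed auto
  then have "((\<lambda>i. sqrt ((norm (L2_inner (F i) (G i) - L2_inner F' (G i)))\<^sup>2)) \<longlongrightarrow> sqrt 0) A"
    by (rule tendsto_real_sqrt)
  then have "((\<lambda>i. norm (L2_inner (F i) (G i) - L2_inner F' (G i))) \<longlongrightarrow> 0) A"
    by simp
  then have "((\<lambda>i. L2_inner (F i) (G i) - L2_inner F' (G i)) \<longlongrightarrow> 0) A"
    using tendsto_norm_zero_iff by blast
  from tendsto_add[OF this 1] show ?thesis by simp
qed

text \<open>The argument of Riesz and Fischer. Along a subsequence \<open>s\<close> whose consecutive squared distances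
  are at most \<open>(1/4)^k\<close>, the increments are absolutely summable almost everywhere, which gives a
  pointwise limit; by Fatou's lemma that limit is also the limit in the mean.\<close>
lemma L2_complete:
  assumes F: "\<And>n::nat. F n \<in> L2_circle"
    and cauchy: "\<And>e. e > 0 \<Longrightarrow> \<exists>N. \<forall>m\<ge>N. \<forall>n\<ge>N. L2_sq (\<lambda>z. F m z - F n z) < e"
  obtains G where "G \<in> L2_circle" "L2_tendsto F G sequentially"
proof -
  have [measurable]: "F n \<in> borel_measurable borel" for n using F L2_measurable by blast
  have "\<exists>N. \<forall>k. \<forall>m\<ge>N k. \<forall>n\<ge>N k. L2_sq (\<lambda>z. F m z - F n z) < (1/4)^k"
    by (intro choice allI cauchy) simp
  then obtain N where N: "\<And>k m n. m \<ge> N k \<Longrightarrow> n \<ge> N k \<Longrightarrow> L2_sq (\<lambda>z. F m z - F n z) < (1/4)^k"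
    by blast
  \<comment> \<open>replace the chosen indices by an increasing sequence that dominates them\<close>
  define M where "M k = Max (N ` {..k})" for k
  have MN: "N k \<le> M k" and M_mono: "k \<le> l \<Longrightarrow> M k \<le> M l" for k l
    unfolding M_def by (auto intro!: Max_mono)
  define s where "s k = F (M k)" for k
  have [measurable]: "s k \<in> borel_measurable borel" for k unfolding s_def by simp
  have sL: "s k \<in> L2_circle" for k unfolding s_def by (rule F)
  define D where "D k z = norm (s (Suc k) z - s k z)" for k z
  have [measurable]: "D k \<in> borel_measurable borel" for k unfolding D_def by measurable
  have D_sq: "L2_sq (\<lambda>z. s (Suc k) z - s k z) \<le> (1/4)^k" for k
    unfolding s_def using N[of k "M (Suc k)" "M k"] MN[of k] M_mono[of k "Suc k"] by force
  define C where "C = measure circle_measure UNIV"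
  have [simp]: "C \<ge> 0" by (simp add: C_def)
  have D_int: "(\<integral>\<^sup>+z. ennreal (D k z) \<partial>circle_measure) \<le> ennreal ((1 + C) * (1/2)^k)" for k
  proof -
    \<comment> \<open>pointwise \<open>D \<le> 2^k D\<^sup>2 + 2^-k\<close> bounds the mean of \<open>D\<close> by its mean square\<close>
    have pt: "D k z \<le> 2^k * (norm (s (Suc k) z - s k z))\<^sup>2 + (1/2)^k" for z
    proof (cases "2^k * D k z \<le> 1")
      case True
      then have "D k z \<le> (1/2)^k" by (simp add: power_divide field_simps)
      then show ?thesis by (simp add: add_increasing)
    next
      case False
      then have "1 * D k z \<le> (2^k * D k z) * D k z" by (intro mult_right_mono) (auto simp: D_def)
      then show ?thesis by (simp add: D_def power2_eq_square mult.assoc add_increasing2)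
    qed
    have i: "integrable circle_measure (\<lambda>z. 2^k * (norm (s (Suc k) z - s k z))\<^sup>2 + (1/2)^k)"
      by (intro Bochner_Integration.integrable_add integrable_mult_right L2_sq_integrable L2_diff sL) simp
    have "(\<integral>\<^sup>+z. ennreal (D k z) \<partial>circle_measure)
        \<le> (\<integral>\<^sup>+z. ennreal (2^k * (norm (s (Suc k) z - s k z))\<^sup>2 + (1/2)^k) \<partial>circle_measure)"
      by (intro nn_integral_mono ennreal_leI pt)
    also have "\<dots> = ennreal (LINT z|circle_measure. 2^k * (norm (s (Suc k) z - s k z))\<^sup>2 + (1/2)^k)"
      by (intro nn_integral_eq_integral i) auto
    also have "(LINT z|circle_measure. 2^k * (norm (s (Suc k) z - s k z))\<^sup>2 + (1/2)^k)
        = 2^k * L2_sq (\<lambda>z. s (Suc k) z - s k z) + C * (1/2)^k"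
      by (subst Bochner_Integration.integral_add)
         (auto intro!: L2_sq_integrable L2_diff sL simp: C_def)
    also have "\<dots> \<le> 2^k * (1/4)^k + C * (1/2)^k"
      by (intro add_mono mult_left_mono D_sq) auto
    also have "\<dots> = (1 + C) * (1/2)^k"
      by (simp add: power_mult_distrib[symmetric] ring_distribs)
    finally show ?thesis by (simp add: ennreal_leI)
  qed
  have "(\<integral>\<^sup>+z. (\<Sum>k. ennreal (D k z)) \<partial>circle_measure) = (\<Sum>k. \<integral>\<^sup>+z. ennreal (D k z) \<partial>circle_measure)"
    by (rule nn_integral_suminf) measurable
  also have "\<dots> \<le> (\<Sum>k. ennreal ((1 + C) * (1/2)^k))"
    by (intro suminf_le D_int) auto
  also have "\<dots> = ennreal (\<Sum>k. (1 + C) * (1/2)^k)"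
    by (rule suminf_ennreal2) (auto intro!: summable_mult)
  finally have "(\<integral>\<^sup>+z. (\<Sum>k. ennreal (D k z)) \<partial>circle_measure) \<noteq> \<infinity>"
    by (auto simp: top_unique)
  then have "AE z in circle_measure. (\<Sum>k. ennreal (D k z)) \<noteq> \<infinity>"
    by (intro nn_integral_noteq_infinite) auto
  then have conv: "AE z in circle_measure. (\<lambda>k. s k z) \<longlonglongrightarrow> lim (\<lambda>k. s k z)"
  proof eventually_elim
    case (elim z)
    then have "summable (\<lambda>k. D k z)"
      by (intro summable_suminf_not_top) (auto simp: D_def)
    then have "summable (\<lambda>k. s (Suc k) z - s k z)"
      unfolding D_def by (rule summable_norm_cancel)
    then have "convergent (\<lambda>n. \<Sum>k<n. s (Suc k) z - s k z)"
      by (simp add: summable_iff_convergent)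
    then have "convergent (\<lambda>n. s n z - s 0 z)"
      by (subst (asm) sum_lessThan_telescope)
    then have "convergent (\<lambda>n. s n z)" by (simp add: convergent_diff_const_right_iff)
    then show ?case by (simp add: convergent_LIMSEQ_iff)
  qed
  define G where "G z = lim (\<lambda>k. s k z)" for z
  have [measurable]: "G \<in> borel_measurable borel" unfolding G_def by measurable
  \<comment> \<open>Fatou's lemma, with \<open>n\<close> fixed and the second index running along the subsequence\<close>
  have bound: "(\<integral>\<^sup>+z. ennreal ((norm (F n z - G z))\<^sup>2) \<partial>circle_measure) \<le> ennreal ((1/4)^j)"
    if n: "n \<ge> N j" for n j
  proof -
    have "(\<integral>\<^sup>+z. ennreal ((norm (F n z - G z))\<^sup>2) \<partial>circle_measure)
        = (\<integral>\<^sup>+z. liminf (\<lambda>k. ennreal ((norm (F n z - s k z))\<^sup>2)) \<partial>circle_measure)"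
    proof (rule nn_integral_cong_AE)
      show "AE z in circle_measure. ennreal ((norm (F n z - G z))\<^sup>2)
          = liminf (\<lambda>k. ennreal ((norm (F n z - s k z))\<^sup>2))"
        using conv
      proof eventually_elim
        case (elim z)
        then have "(\<lambda>k. s k z) \<longlonglongrightarrow> G z" by (simp add: G_def)
        then have "(\<lambda>k. ennreal ((norm (F n z - s k z))\<^sup>2)) \<longlonglongrightarrow> ennreal ((norm (F n z - G z))\<^sup>2)"
          by (intro tendsto_intros)
        then show ?case by (intro lim_imp_Liminf[symmetric]) auto
      qed
    qed
    also have "\<dots> \<le> liminf (\<lambda>k. \<integral>\<^sup>+z. ennreal ((norm (F n z - s k z))\<^sup>2) \<partial>circle_measure)"
      by (rule nn_integral_liminf) measurable
    also have "\<dots> \<le> limsup (\<lambda>k. \<integral>\<^sup>+z. ennreal ((norm (F n z - s k z))\<^sup>2) \<partial>circle_measure)"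
      by (intro Liminf_le_Limsup) auto
    also have "\<dots> \<le> ennreal ((1/4)^j)"
    proof (rule Limsup_bounded)
      show "\<forall>\<^sub>F k in sequentially. (\<integral>\<^sup>+z. ennreal ((norm (F n z - s k z))\<^sup>2) \<partial>circle_measure) \<le> ennreal ((1/4)^j)"
        using eventually_ge_at_top[of j]
      proof eventually_elim
        case (elim k)
        then have "M k \<ge> N j" using MN[of j] M_mono[of j k] by linarith
        then have "L2_sq (\<lambda>z. F n z - s k z) \<le> (1/4)^j" unfolding s_def using N[OF n] by force
        then show ?case
          by (subst nn_integral_eq_integral) (auto intro!: L2_sq_integrable L2_diff F sL ennreal_leI)
      qed
    qed
    finally show ?thesis .
  qed
  have FG: "(\<lambda>z. F n z - G z) \<in> L2_circle" if "n \<ge> N j" for n j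
    using bound[OF that] unfolding L2_circle_def
    by (auto simp: integrable_iff_bounded top.not_eq_extremum intro: le_less_trans)
  have G: "G \<in> L2_circle"
    using L2_diff[OF F[of "N 0"] FG[of 0 "N 0"]] by simp
  moreover have "L2_tendsto F G sequentially"
    unfolding L2_tendsto_def
  proof (rule LIMSEQ_I)
    fix r :: real assume "r > 0"
    then obtain j where j: "(1/4)^j < r" using real_arch_pow_inv[of r "1/4"] by auto
    have "L2_sq (\<lambda>z. F n z - G z) < r" if "n \<ge> N j" for n
    proof -
      have "ennreal (L2_sq (\<lambda>z. F n z - G z)) \<le> ennreal ((1/4)^j)"
        using bound[OF that] by (subst (asm) nn_integral_eq_integral) (auto intro!: L2_sq_integrable L2_diff F G)
      then show ?thesis using j by (simp add: ennreal_le_iff)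
    qed
    then show "\<exists>no. \<forall>n\<ge>no. norm (L2_sq (\<lambda>z. F n z - G z) - 0) < r" by (auto intro!: exI[of _ "N j"])
  qed
  ultimately show ?thesis by (rule that)
qed

section \<open>Taylor coefficients\<close>

text \<open>Since \<^const>\<open>taylor_coeff\<close> only looks at derivatives at the origin, it reads off the coefficients
  of any power series that represents the function in the disk.\<close>
lemma taylor_coeff_eqI:
  assumes sums: "\<And>z. norm z < 1 \<Longrightarrow> (\<lambda>n. c n * z ^ n) sums f z"
  shows "taylor_coeff f = c"
proof
  fix n
  have "f has_fps_expansion Abs_fps c"
    unfolding has_fps_expansion_def
  proof (rule conjI)
    have c: "fps_nth (Abs_fps c) = c" by (simp add: fun_eq_iff)
    have "summable (\<lambda>n. c n * (1/2) ^ n)" by (rule sums_summable[OF sums]) simp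
    then have "conv_radius c \<ge> norm (1/2 :: complex)" by (rule conv_radius_geI)
    then show "fps_conv_radius (Abs_fps c) > 0"
      unfolding fps_conv_radius_def c by (rule less_le_trans[rotated]) simp
    have "eventually (\<lambda>z. z \<in> ball 0 1) (nhds (0::complex))"
      by (intro eventually_nhds_in_open) auto
    then show "\<forall>\<^sub>F z in nhds 0. eval_fps (Abs_fps c) z = f z"
      by eventually_elim (use sums in \<open>auto simp: eval_fps_def sums_iff\<close>)
  qed
  from fps_nth_fps_expansion[OF this, of n] show "taylor_coeff f n = c n"
    by (simp add: taylor_coeff_def)
qed

lemma hardy_sums:
  "f \<in> hardy2 \<Longrightarrow> norm z < 1 \<Longrightarrow> (\<lambda>n. taylor_coeff f n * z ^ n) sums f z"
  using holomorphic_power_series[of f 0 1 z] by (auto simp: hardy2_def taylor_coeff_def)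

lemma hardy_summable: "f \<in> hardy2 \<Longrightarrow> summable (\<lambda>n. (norm (taylor_coeff f n))\<^sup>2)"
  by (simp add: hardy2_def)

lemma hardy_outside: "f \<in> hardy2 \<Longrightarrow> \<not> norm z < 1 \<Longrightarrow> f z = 0"
  by (simp add: hardy2_def)

text \<open>For square-summable \<open>c\<close> this inverts \<^const>\<open>taylor_coeff\<close>; the value \<open>0\<close> outside the disk
  is the normalisation required by \<^const>\<open>hardy2\<close>.\<close>
definition hardy_of :: "(nat \<Rightarrow> complex) \<Rightarrow> complex \<Rightarrow> complex" where
  "hardy_of c z = (if norm z < 1 then \<Sum>n. c n * z ^ n else 0)"

lemma square_summable_bounded:
  fixes c :: "nat \<Rightarrow> complex"
  assumes "summable (\<lambda>n. (norm (c n))\<^sup>2)"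
  shows "norm (c n) \<le> sqrt (\<Sum>n. (norm (c n))\<^sup>2)"
  using sum_le_suminf[OF assms, of "{n}"] by (intro real_le_rsqrt) simp

text \<open>Square-summable coefficients are bounded, so the power series is dominated by a geometric one.\<close>
lemma square_summable_imp_norm_summable:
  fixes c :: "nat \<Rightarrow> complex"
  assumes "summable (\<lambda>n. (norm (c n))\<^sup>2)" "0 \<le> r" "r < 1"
  shows "summable (\<lambda>n. norm (c n) * r ^ n)"
proof (rule summable_comparison_test')
  show "summable (\<lambda>n. sqrt (\<Sum>n. (norm (c n))\<^sup>2) * r ^ n)"
    using assms by (intro summable_mult summable_geometric) auto
  show "norm (norm (c n) * r ^ n) \<le> sqrt (\<Sum>n. (norm (c n))\<^sup>2) * r ^ n" for n
    using square_summable_bounded[OF assms(1)] assms by (auto simp: abs_mult intro!: mult_right_mono)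
qed

lemma hardy_of_sums:
  assumes "summable (\<lambda>n. (norm (c n))\<^sup>2)" "norm z < 1"
  shows "(\<lambda>n. c n * z ^ n) sums hardy_of c z"
proof -
  have "summable (\<lambda>n. c n * z ^ n)"
    using square_summable_imp_norm_summable[OF assms(1) _ assms(2)]
    by (intro summable_norm_cancel[of "\<lambda>n. c n * z ^ n"]) (simp add: norm_mult norm_power)
  then show ?thesis using assms by (simp add: hardy_of_def summable_sums)
qed

lemma taylor_coeff_hardy_of:
  assumes "summable (\<lambda>n. (norm (c n))\<^sup>2)"
  shows "taylor_coeff (hardy_of c) = c"
  by (intro taylor_coeff_eqI hardy_of_sums assms)

lemma hardy_of_in_hardy2:
  assumes "summable (\<lambda>n. (norm (c n))\<^sup>2)"
  shows "hardy_of c \<in> hardy2"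
proof -
  have "hardy_of c holomorphic_on ball 0 1"
    using hardy_of_sums[OF assms]
    by (intro power_series_holomorphic[of 0 1 c]) auto
  then show ?thesis using assms by (simp add: hardy2_def taylor_coeff_hardy_of) (simp add: hardy_of_def)
qed

lemma hardy_of_taylor_coeff:
  assumes "f \<in> hardy2"
  shows "hardy_of (taylor_coeff f) = f"
proof
  show "hardy_of (taylor_coeff f) z = f z" for z
    using sums_unique[OF hardy_sums[OF assms, of z]] hardy_outside[OF assms, of z] by (simp add: hardy_of_def)
qed

lemma hardy_scale:
  assumes "f \<in> hardy2"
  shows "(\<lambda>z. c * f z) \<in> hardy2"
    and taylor_coeff_scale: "taylor_coeff (\<lambda>z. c * f z) = (\<lambda>n. c * taylor_coeff f n)"
proof -
  show *: "taylor_coeff (\<lambda>z. c * f z) = (\<lambda>n. c * taylor_coeff f n)"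
    using assms by (intro taylor_coeff_eqI) (auto simp: mult.assoc intro!: sums_mult hardy_sums)
  show "(\<lambda>z. c * f z) \<in> hardy2"
    using assms unfolding hardy2_def mem_Collect_eq *
    by (auto simp: norm_mult power_mult_distrib intro!: holomorphic_intros summable_mult)
qed

lemma hardy_add:
  assumes "f \<in> hardy2" "g \<in> hardy2"
  shows "(\<lambda>z. f z + g z) \<in> hardy2"
    and taylor_coeff_add: "taylor_coeff (\<lambda>z. f z + g z) = (\<lambda>n. taylor_coeff f n + taylor_coeff g n)"
proof -
  show *: "taylor_coeff (\<lambda>z. f z + g z) = (\<lambda>n. taylor_coeff f n + taylor_coeff g n)"
    using assms by (intro taylor_coeff_eqI) (auto simp: ring_distribs intro!: sums_add hardy_sums)
  have "summable (\<lambda>n. (norm (taylor_coeff f n + taylor_coeff g n))\<^sup>2)"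
  proof (rule summable_comparison_test')
    show "summable (\<lambda>n. 2 * (norm (taylor_coeff f n))\<^sup>2 + 2 * (norm (taylor_coeff g n))\<^sup>2)"
      using assms by (intro summable_add summable_mult hardy_summable)
  qed (simp add: norm_add_sq_le)
  then show "(\<lambda>z. f z + g z) \<in> hardy2"
    using assms unfolding hardy2_def mem_Collect_eq * by (auto intro!: holomorphic_intros)
qed

lemma hardy_diff:
  assumes "f \<in> hardy2" "g \<in> hardy2"
  shows "(\<lambda>z. f z - g z) \<in> hardy2"
    and taylor_coeff_diff: "taylor_coeff (\<lambda>z. f z - g z) = (\<lambda>n. taylor_coeff f n - taylor_coeff g n)"
  using hardy_add[OF assms(1) hardy_scale(1)[OF assms(2), of "-1"]]
    taylor_coeff_scale[OF assms(2), of "-1"] by simp_all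

lemma hardy_zero: "(\<lambda>z. 0) \<in> hardy2"
proof -
  have "taylor_coeff (\<lambda>z. 0) = (\<lambda>n. 0)"
    by (rule taylor_coeff_eqI) simp
  then show ?thesis by (simp add: hardy2_def)
qed

lemma hardy_measurable: 
  assumes "f \<in> hardy2" shows "f \<in> borel_measurable borel"
proof -
  have "continuous_on (ball 0 1) f"
    using assms by (auto simp: hardy2_def intro: holomorphic_on_imp_continuous_on)
  then have "(\<lambda>z. indicator (ball 0 1) z *\<^sub>R f z) \<in> borel_measurable borel"
    by (intro borel_measurable_continuous_on_indicator) auto
  moreover have "(\<lambda>z. indicator (ball 0 1) z *\<^sub>R f z) = f"
    using hardy_outside[OF assms] by (auto simp: fun_eq_iff indicator_def)
  ultimately show ?thesis by simp
qed

lemma taylor_coeff_monomial: "taylor_coeff (\<lambda>z. z ^ n) m = (if m = n then 1 else 0)"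
proof -
  have "taylor_coeff (\<lambda>z. z ^ n) = (\<lambda>m. if m = n then 1 else 0)"
  proof (rule taylor_coeff_eqI)
    show "(\<lambda>m. (if m = n then 1 else 0) * z ^ m) sums z ^ n" for z :: complex
      using sums_single[of n "\<lambda>m. z ^ m"] by (simp add: if_distribR if_distrib[of "\<lambda>x. x * _"] cong: if_cong)
  qed
  then show ?thesis by simp
qed

section \<open>Boundary functions as limits of Taylor polynomials\<close>

lemma monomial_disk_algebra: "(\<lambda>z. z ^ n) \<in> disk_algebra"
  by (intro disk_algebra_power disk_algebra_id)

lemma monomial_L2: "(\<lambda>z. z ^ n) \<in> L2_circle"
  by (intro disk_algebra_L2 monomial_disk_algebra)

lemma L2_inner_monomial:
  assumes "p \<in> disk_algebra"
  shows "L2_inner p (\<lambda>z. z ^ n) = taylor_coeff p n"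
  using circle_integral_fourier[OF assms, of n] by (simp add: L2_inner_def)

text \<open>Orthonormality of the monomials on the circle, extended sesquilinearly to polynomials.\<close>
lemma L2_inner_trig_polynomial:
  assumes "finite I" "finite J"
  shows "L2_inner (\<lambda>z. \<Sum>i\<in>I. c i * z ^ i) (\<lambda>z. \<Sum>j\<in>J. d j * z ^ j) = (\<Sum>i\<in>I\<inter>J. c i * cnj (d i))"
proof -
  have "L2_inner (\<lambda>z. \<Sum>i\<in>I. c i * z ^ i) (\<lambda>z. \<Sum>j\<in>J. d j * z ^ j)
      = (\<Sum>i\<in>I. c i * (\<Sum>j\<in>J. cnj (d j) * L2_inner (\<lambda>z. z ^ i) (\<lambda>z. z ^ j)))"
    by (subst L2_inner_sum_left, (intro monomial_L2 disk_algebra_L2 disk_algebra_sum disk_algebra_mult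
          disk_algebra_const monomial_disk_algebra)+, subst L2_inner_sum_right, (intro monomial_L2)+) simp
  also have "\<dots> = (\<Sum>i\<in>I. c i * (\<Sum>j\<in>J. if j = i then cnj (d j) else 0))"
    by (intro sum.cong refl arg_cong[of _ _ "\<lambda>x. c _ * x"])
       (simp add: L2_inner_monomial[OF monomial_disk_algebra] taylor_coeff_monomial)
  also have "\<dots> = (\<Sum>i\<in>I. if i \<in> J then c i * cnj (d i) else 0)"
    using assms by (intro sum.cong refl) simp
  also have "\<dots> = (\<Sum>i\<in>I\<inter>J. c i * cnj (d i))"
    using assms by (simp add: sum.inter_restrict)
  finally show ?thesis .
qed

lemma L2_sq_trig_polynomial:
  assumes "finite I"
  shows "L2_sq (\<lambda>z. \<Sum>i\<in>I. c i * z ^ i) = (\<Sum>i\<in>I. (norm (c i))\<^sup>2)"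
proof -
  have "complex_of_real (L2_sq (\<lambda>z. \<Sum>i\<in>I. c i * z ^ i)) = of_real (\<Sum>i\<in>I. (norm (c i))\<^sup>2)"
    unfolding L2_inner_self[symmetric] using L2_inner_trig_polynomial[OF assms assms, of c c]
    by (simp add: complex_norm_square[symmetric])
  then show ?thesis using of_real_eq_iff by blast
qed

definition taylor_poly :: "(complex \<Rightarrow> complex) \<Rightarrow> nat \<Rightarrow> complex \<Rightarrow> complex" where
  "taylor_poly f N z = (\<Sum>n<N. taylor_coeff f n * z ^ n)"

lemma taylor_poly_disk_algebra: "taylor_poly f N \<in> disk_algebra"
  unfolding taylor_poly_def[abs_def]
  by (intro disk_algebra_sum disk_algebra_mult disk_algebra_const monomial_disk_algebra)

lemma taylor_poly_L2: "taylor_poly f N \<in> L2_circle"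
  by (intro disk_algebra_L2 taylor_poly_disk_algebra)

text \<open>Boundary functions are introduced as limits of Taylor polynomials rather than of dilates: for
  polynomials all inner products are finite sums, which makes Parseval's identity immediate. The
  agreement with \<^const>\<open>is_boundary\<close> is a separate theorem below.\<close>
definition has_trace :: "(complex \<Rightarrow> complex) \<Rightarrow> (complex \<Rightarrow> complex) \<Rightarrow> bool" where
  "has_trace f F \<longleftrightarrow> f \<in> hardy2 \<and> F \<in> L2_circle \<and> L2_tendsto (taylor_poly f) F sequentially"

lemma trace_exists:
  assumes f: "f \<in> hardy2"
  obtains F where "has_trace f F"
proof -
  have "\<exists>N. \<forall>m\<ge>N. \<forall>n\<ge>N. L2_sq (\<lambda>z. taylor_poly f m z - taylor_poly f n z) < e" if e: "e > 0" for e
  proof -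
    define a where "a n = (norm (taylor_coeff f n))\<^sup>2" for n
    have "Cauchy (\<lambda>n. \<Sum>k<n. a k)"
      using hardy_summable[OF f] unfolding a_def by (simp add: summable_iff_convergent Cauchy_convergent_iff)
    then obtain N where N: "\<And>m n. m \<ge> N \<Longrightarrow> n \<ge> N \<Longrightarrow> dist (\<Sum>k<m. a k) (\<Sum>k<n. a k) < e"
      using e unfolding Cauchy_def by blast
    have le: "L2_sq (\<lambda>z. taylor_poly f m z - taylor_poly f n z) < e" if mn: "m \<ge> n" "n \<ge> N" for m n
    proof -
      have s: "(\<Sum>k<m. b k) - (\<Sum>k<n. b k) = (\<Sum>k\<in>{..<m} - {..<n}. b k)" for b :: "nat \<Rightarrow> 'a::ab_group_add"
        using mn by (subst sum_diff) auto
      have "L2_sq (\<lambda>z. taylor_poly f m z - taylor_poly f n z) = (\<Sum>k\<in>{..<m} - {..<n}. a k)"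
        unfolding taylor_poly_def s a_def by (rule L2_sq_trig_polynomial) simp
      also have "\<dots> = (\<Sum>k<m. a k) - (\<Sum>k<n. a k)" by (rule s[symmetric])
      also have "\<dots> < e" using N[of m n] mn by (auto simp: dist_real_def)
      finally show ?thesis .
    qed
    show ?thesis
    proof (intro exI allI impI)
      fix m n assume "m \<ge> N" "n \<ge> N"
      then show "L2_sq (\<lambda>z. taylor_poly f m z - taylor_poly f n z) < e"
        using le[of n m] le[of m n] L2_sq_commute[of "taylor_poly f m" "taylor_poly f n"]
        by (cases "m \<ge> n") auto
    qed
  qed
  from L2_complete[OF taylor_poly_L2 this] show ?thesis
    using f that unfolding has_trace_def by blast
qed

lemma trace_hardy: "has_trace f F \<Longrightarrow> f \<in> hardy2" and trace_L2: "has_trace f F \<Longrightarrow> F \<in> L2_circle"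
  by (auto simp: has_trace_def)

lemma trace_inner_tendsto:
  "has_trace f F \<Longrightarrow> G \<in> L2_circle \<Longrightarrow> (\<lambda>N. L2_inner (taylor_poly f N) G) \<longlonglongrightarrow> L2_inner F G"
  unfolding has_trace_def by (intro L2_inner_tendsto_left taylor_poly_L2) auto

text \<open>Parseval's identity. Summability of the products is part of the conclusion: the partial sums are
  the inner products of the Taylor polynomials, which converge.\<close>
lemma trace_sums:
  assumes F: "has_trace f F" and G: "has_trace g G"
  shows "(\<lambda>n. taylor_coeff f n * cnj (taylor_coeff g n)) sums L2_inner F G"
proof -
  have "(\<lambda>N. L2_inner (taylor_poly f N) (taylor_poly g N)) \<longlonglongrightarrow> L2_inner F G"
    using F G unfolding has_trace_def by (intro L2_inner_tendsto taylor_poly_L2) auto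
  moreover have "L2_inner (taylor_poly f N) (taylor_poly g N)
      = (\<Sum>n<N. taylor_coeff f n * cnj (taylor_coeff g n))" for N
    unfolding taylor_poly_def[abs_def] by (subst L2_inner_trig_polynomial) auto
  ultimately show ?thesis unfolding sums_def by simp
qed

lemma trace_inner: "has_trace f F \<Longrightarrow> has_trace g G \<Longrightarrow> hardy_inner f g = L2_inner F G"
  using trace_sums by (simp add: hardy_inner_def sums_iff)

lemma trace_L2_sq:
  assumes "has_trace f F" shows "L2_sq F = (\<Sum>n. (norm (taylor_coeff f n))\<^sup>2)"
proof -
  have "(\<lambda>n. complex_of_real ((norm (taylor_coeff f n))\<^sup>2)) sums of_real (L2_sq F)"
    using trace_sums[OF assms assms] by (simp only: L2_inner_self complex_norm_square[symmetric])
  then show ?thesis using sums_of_real_iff sums_unique by blast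
qed

lemma trace_coeff:
  assumes F: "has_trace f F"
  shows "L2_inner F (\<lambda>z. z ^ n) = taylor_coeff f n"
proof -
  have "(\<lambda>N. L2_inner (taylor_poly f N) (\<lambda>z. z ^ n)) \<longlonglongrightarrow> L2_inner F (\<lambda>z. z ^ n)"
    by (intro trace_inner_tendsto F monomial_L2)
  moreover have "\<forall>\<^sub>F N in sequentially. L2_inner (taylor_poly f N) (\<lambda>z. z ^ n) = taylor_coeff f n"
    using eventually_gt_at_top[of n]
  proof eventually_elim
    case (elim N)
    then show ?case
      using L2_inner_trig_polynomial[of "{..<N}" "{n}" "taylor_coeff f" "\<lambda>_. 1"]
      by (simp add: taylor_poly_def[abs_def] Int_absorb1)
  qed
  then have "(\<lambda>N. L2_inner (taylor_poly f N) (\<lambda>z. z ^ n)) \<longlonglongrightarrow> taylor_coeff f n"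
    by (rule tendsto_eventually)
  ultimately show ?thesis by (rule LIMSEQ_unique)
qed

lemma trace_diff:
  assumes "has_trace f F" "has_trace g G"
  shows "has_trace (\<lambda>z. f z - g z) (\<lambda>z. F z - G z)"
proof -
  have p: "taylor_poly (\<lambda>z. f z - g z) N z = taylor_poly f N z - taylor_poly g N z" for N z
    using taylor_coeff_diff[of f g] assms
    by (simp add: taylor_poly_def trace_hardy sum_subtractf ring_distribs)
  have "L2_tendsto (taylor_poly (\<lambda>z. f z - g z)) (\<lambda>z. F z - G z) sequentially"
    unfolding L2_tendsto_def p
  proof (rule tendsto_sandwich[OF _ _ tendsto_const])
    show "\<forall>\<^sub>F N in sequentially. L2_sq (\<lambda>z. taylor_poly f N z - taylor_poly g N z - (F z - G z))
       \<le> 2 * L2_sq (\<lambda>z. taylor_poly f N z - F z) + 2 * L2_sq (\<lambda>z. taylor_poly g N z - G z)"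
    proof (intro always_eventually allI)
      fix N
      show "L2_sq (\<lambda>z. taylor_poly f N z - taylor_poly g N z - (F z - G z))
       \<le> 2 * L2_sq (\<lambda>z. taylor_poly f N z - F z) + 2 * L2_sq (\<lambda>z. taylor_poly g N z - G z)"
        using L2_sq_add_le[OF L2_diff[OF taylor_poly_L2[of f N] trace_L2[OF assms(1)]]
            L2_diff[OF trace_L2[OF assms(2)] taylor_poly_L2[of g N]]]
          L2_sq_commute[of G "taylor_poly g N"]
        by (simp add: algebra_simps)
    qed
    have "(\<lambda>N. 2 * L2_sq (\<lambda>z. taylor_poly f N z - F z) + 2 * L2_sq (\<lambda>z. taylor_poly g N z - G z))
       \<longlonglongrightarrow> 2 * 0 + 2 * 0"
      using assms unfolding has_trace_def by (intro tendsto_intros L2_tendsto_D) auto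
    then show "(\<lambda>N. 2 * L2_sq (\<lambda>z. taylor_poly f N z - F z) + 2 * L2_sq (\<lambda>z. taylor_poly g N z - G z))
       \<longlonglongrightarrow> 0" by simp
  qed auto
  then show ?thesis using assms by (auto simp: has_trace_def intro!: L2_diff hardy_diff)
qed

lemma trace_cong_AE:
  assumes F: "has_trace f F" and G: "G \<in> L2_circle" and ae: "AE z in circle_measure. F z = G z"
  shows "has_trace f G"
proof -
  have [measurable]: "F \<in> L2_circle" "G \<in> L2_circle" using F G by (auto simp: has_trace_def)
  have [measurable]: "taylor_poly f N \<in> borel_measurable borel" for N
    using taylor_poly_L2 by (auto simp: L2_circle_def)
  have "L2_sq (\<lambda>z. taylor_poly f N z - F z) = L2_sq (\<lambda>z. taylor_poly f N z - G z)" for N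
    by (rule integral_cong_AE) (use ae in \<open>auto\<close>)
  then show ?thesis using F G by (simp add: has_trace_def L2_tendsto_def)
qed

lemma trace_unique:
  assumes "has_trace f F" "has_trace f G"
  shows "AE z in circle_measure. F z = G z"
  using assms by (intro L2_tendsto_unique[of "taylor_poly f" F sequentially G])
    (auto simp: has_trace_def taylor_poly_L2)

section \<open>Boundary functions as limits of dilates\<close>

lemma hardy_dilate_L2:
  assumes f: "f \<in> hardy2"
  shows "(\<lambda>z. f (of_real r * z)) \<in> L2_circle"
proof -
  have [measurable]: "f \<in> borel_measurable borel" by (rule hardy_measurable[OF f])
  obtain K where K: "\<And>z. norm z = 1 \<Longrightarrow> norm (f (of_real r * z)) \<le> K"
  proof (cases "\<bar>r\<bar> < 1")
    case True
    have "continuous_on (ball 0 1) f" using f by (auto simp: hardy2_def holomorphic_on_imp_continuous_on)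
    then have "continuous_on (cball 0 \<bar>r\<bar>) f" by (rule continuous_on_subset) (use True in auto)
    then have "bounded (f ` cball 0 \<bar>r\<bar>)" by (intro compact_imp_bounded compact_continuous_image) auto
    then obtain K where "\<forall>z\<in>cball 0 \<bar>r\<bar>. norm (f z) \<le> K" by (auto simp: bounded_iff)
    then show ?thesis by (intro that[of K]) (auto simp: norm_mult)
  next
    case False
    then show ?thesis using hardy_outside[OF f] by (intro that[of 0]) (auto simp: norm_mult)
  qed
  show ?thesis by (rule L2_bounded[OF _ K]) measurable
qed

text \<open>Dilating by \<open>r\<close> multiplies the \<open>n\<close>-th coefficient by \<open>r^n \<le> 1\<close>. As \<open>r < 1\<close>, the
  Taylor series converges boundedly on the circle of radius \<open>r\<close>, and dominated convergence transfers
  the bound from the Taylor polynomials.\<close>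
lemma L2_sq_hardy_dilate_le:
  assumes f: "f \<in> hardy2" and r: "0 \<le> r" "r < 1"
  shows "L2_sq (\<lambda>z. f (of_real r * z)) \<le> (\<Sum>n. (norm (taylor_coeff f n))\<^sup>2)"
proof -
  have [measurable]: "f \<in> borel_measurable borel" by (rule hardy_measurable[OF f])
  define c where "c = taylor_coeff f"
  define B where "B = (\<Sum>n. norm (c n) * r ^ n)"
  define S where "S N z = (\<Sum>n<N. (c n * of_real r ^ n) * z ^ n)" for N and z :: complex
  have S_eq: "S N z = (\<Sum>n<N. c n * (of_real r * z) ^ n)" for N z
    by (simp add: S_def power_mult_distrib mult.assoc)
  have sm: "summable (\<lambda>n. norm (c n) * r ^ n)"
    unfolding c_def by (intro square_summable_imp_norm_summable hardy_summable f r)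
  have "(\<lambda>N. L2_sq (S N)) \<longlonglongrightarrow> L2_sq (\<lambda>z. f (of_real r * z))"
  proof (rule integral_dominated_convergence)
    show "AE z in circle_measure. (\<lambda>N. (norm (S N z))\<^sup>2) \<longlonglongrightarrow> (norm (f (of_real r * z)))\<^sup>2"
      using AE_circle_measure
    proof eventually_elim
      case (elim z)
      then have "norm (of_real r * z) < 1" using r by (simp add: norm_mult)
      from hardy_sums[OF f this] have "(\<lambda>N. S N z) \<longlonglongrightarrow> f (of_real r * z)"
        by (simp add: sums_def S_eq c_def)
      then show ?case by (intro tendsto_intros)
    qed
    show "AE z in circle_measure. norm ((norm (S N z))\<^sup>2) \<le> B\<^sup>2" for N
      using AE_circle_measure
    proof eventually_elim
      case (elim z)
      have "norm (S N z) \<le> (\<Sum>n<N. norm (c n * of_real r ^ n * z ^ n))" unfolding S_def by (rule norm_sum)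
      also have "\<dots> = (\<Sum>n<N. norm (c n) * r ^ n)" using r elim by (simp add: norm_mult norm_power)
      also have "\<dots> \<le> B" unfolding B_def using r by (intro sum_le_suminf sm) auto
      finally show ?case by (simp add: power_mono)
    qed
    show "(\<lambda>z. (norm (S N z))\<^sup>2) \<in> borel_measurable circle_measure" for N
      unfolding S_def by measurable
  qed (auto simp: c_def)
  moreover have "L2_sq (S N) \<le> (\<Sum>n. (norm (c n))\<^sup>2)" for N
  proof -
    have "L2_sq (S N) = (\<Sum>n<N. (norm (c n * of_real r ^ n))\<^sup>2)"
      unfolding S_def by (rule L2_sq_trig_polynomial) simp
    also have "\<dots> \<le> (\<Sum>n<N. (norm (c n))\<^sup>2)"
      using r by (intro sum_mono power_mono) (auto simp: norm_mult norm_power mult_left_le power_le_one)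
    also have "\<dots> \<le> (\<Sum>n. (norm (c n))\<^sup>2)"
      unfolding c_def using hardy_summable[OF f] by (rule sum_le_suminf) auto
    finally show ?thesis .
  qed
  ultimately show ?thesis unfolding c_def[symmetric] by (intro LIMSEQ_le_const2) auto
qed

text \<open>Approximate \<open>f\<close> by a Taylor polynomial. The remainder is small in the mean uniformly in the
  dilation, by the previous lemma, and for a fixed polynomial the dilates converge.\<close>
lemma trace_imp_is_boundary:
  assumes F: "has_trace f F"
  shows "is_boundary f F"
proof -
  have f: "f \<in> hardy2" and FL: "F \<in> L2_circle" using F by (auto simp: has_trace_def)
  have [measurable]: "f \<in> borel_measurable borel" by (rule hardy_measurable[OF f])
  define c where "c = taylor_coeff f"
  have sm: "summable (\<lambda>n. (norm (c n))\<^sup>2)" unfolding c_def by (rule hardy_summable[OF f])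
  define T where "T N = (\<Sum>n. (norm (c n))\<^sup>2) - (\<Sum>n<N. (norm (c n))\<^sup>2)" for N
  have T: "T \<longlonglongrightarrow> 0"
    using tendsto_diff[OF tendsto_const summable_LIMSEQ[OF sm], of "\<Sum>n. (norm (c n))\<^sup>2"]
    unfolding T_def by simp
  have tail: "L2_sq (\<lambda>z. f (of_real r * z) - taylor_poly f N (of_real r * z)) \<le> T N"
    if r: "0 \<le> r" "r < 1" for r N
  proof -
    \<comment> \<open>the remainder is itself a function in the Hardy space, with the first \<open>N\<close> coefficients erased\<close>
    define d where "d n = (if n < N then 0 else c n)" for n
    have "(\<lambda>n. (norm (c n))\<^sup>2 - (if n \<in> {..<N} then (norm (c n))\<^sup>2 else 0)) sums T N"
      unfolding T_def by (intro sums_diff sums_If_finite_set summable_sums sm) auto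
    also have "(\<lambda>n. (norm (c n))\<^sup>2 - (if n \<in> {..<N} then (norm (c n))\<^sup>2 else 0)) = (\<lambda>n. (norm (d n))\<^sup>2)"
      by (auto simp: d_def)
    finally have d: "(\<lambda>n. (norm (d n))\<^sup>2) sums T N" .
    have eq: "hardy_of d w = f w - taylor_poly f N w" if w: "norm w < 1" for w
    proof -
      have "(\<lambda>n. c n * w ^ n - (if n \<in> {..<N} then c n * w ^ n else 0)) sums (f w - taylor_poly f N w)"
        unfolding taylor_poly_def c_def by (intro sums_diff hardy_sums f w sums_If_finite_set) auto
      also have "(\<lambda>n. c n * w ^ n - (if n \<in> {..<N} then c n * w ^ n else 0)) = (\<lambda>n. d n * w ^ n)"
        by (auto simp: d_def)
      finally show ?thesis using hardy_of_sums[OF sums_summable[OF d] w] sums_unique2 by blast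
    qed
    have dm: "hardy_of d \<in> hardy2" using d by (intro hardy_of_in_hardy2 sums_summable)
    have [measurable]: "hardy_of d \<in> borel_measurable borel" by (rule hardy_measurable[OF dm])
    have [measurable]: "taylor_poly f N \<in> borel_measurable borel"
      by (rule L2_measurable[OF taylor_poly_L2])
    have "L2_sq (\<lambda>z. f (of_real r * z) - taylor_poly f N (of_real r * z)) = L2_sq (\<lambda>z. hardy_of d (of_real r * z))"
    proof (rule integral_cong_AE)
      show "AE z in circle_measure. (norm (f (of_real r * z) - taylor_poly f N (of_real r * z)))\<^sup>2
          = (norm (hardy_of d (of_real r * z)))\<^sup>2"
        using AE_circle_measure by eventually_elim (subst eq, use r in \<open>auto simp: norm_mult\<close>)
    qed measurable
    also have "\<dots> \<le> (\<Sum>n. (norm (d n))\<^sup>2)"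
      using L2_sq_hardy_dilate_le[OF dm r] taylor_coeff_hardy_of[OF sums_summable[OF d]] by simp
    also have "\<dots> = T N" using d by (simp add: sums_iff)
    finally show ?thesis .
  qed
  have pd: "(\<lambda>z. taylor_poly f N (of_real r * z)) \<in> L2_circle" for N r
    unfolding taylor_poly_def power_mult_distrib mult.assoc[symmetric]
    by (intro disk_algebra_L2 disk_algebra_sum disk_algebra_mult disk_algebra_const monomial_disk_algebra)
  have poly: "((\<lambda>r. L2_sq (\<lambda>z. taylor_poly f N (of_real r * z) - taylor_poly f N z)) \<longlongrightarrow> 0) (at_left 1)" for N
  proof -
    have "L2_sq (\<lambda>z. taylor_poly f N (of_real r * z) - taylor_poly f N z)
        = (\<Sum>n<N. (norm (c n * of_real r ^ n - c n))\<^sup>2)" for r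
      unfolding L2_sq_trig_polynomial[OF finite_lessThan, symmetric]
      by (simp add: taylor_poly_def c_def power_mult_distrib ring_distribs sum_subtractf mult.assoc)
    moreover have "((\<lambda>r::real. \<Sum>n<N. (norm (c n * of_real r ^ n - c n))\<^sup>2)
        \<longlongrightarrow> (\<Sum>n<N. (norm (c n * of_real 1 ^ n - c n))\<^sup>2)) (at_left 1)"
      by (intro tendsto_intros)
    ultimately show ?thesis by simp
  qed
  have "((\<lambda>r::real. L2_sq (\<lambda>z. f (of_real r * z) - F z)) \<longlongrightarrow> 0) (at_left 1)"
  proof (rule tendstoI)
    fix e :: real assume e: "e > 0"
    \<comment> \<open>the tolerances add up to \<open>2(e/8) + 4(e/16) + 4(e/16) < e\<close> in the estimate below\<close>
    have "\<forall>\<^sub>F N in sequentially. T N < e/8" using order_tendstoD(2)[OF T, of "e/8"] e by simp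
    moreover have "\<forall>\<^sub>F N in sequentially. L2_sq (\<lambda>z. taylor_poly f N z - F z) < e/16"
      using F e unfolding has_trace_def L2_tendsto_def by (intro order_tendstoD(2)) auto
    ultimately have "\<forall>\<^sub>F N in sequentially. T N < e/8 \<and> L2_sq (\<lambda>z. taylor_poly f N z - F z) < e/16"
      by (rule eventually_conj)
    then obtain N where N: "T N < e/8" "L2_sq (\<lambda>z. taylor_poly f N z - F z) < e/16"
      by (auto simp: eventually_sequentially)
    have "\<forall>\<^sub>F r in at_left 1. L2_sq (\<lambda>z. taylor_poly f N (of_real r * z) - taylor_poly f N z) < e/16"
      using poly[of N] e by (intro order_tendstoD(2)) auto
    moreover have "\<forall>\<^sub>F r in at_left (1::real). r \<in> {0<..<1}"
      by (rule eventually_at_left_real) simp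
    ultimately show "\<forall>\<^sub>F r in at_left 1. dist (L2_sq (\<lambda>z. f (of_real r * z) - F z)) 0 < e"
    proof eventually_elim
      case (elim r)
      have "L2_sq (\<lambda>z. f (of_real r * z) - F z)
        \<le> 2 * L2_sq (\<lambda>z. f (of_real r * z) - taylor_poly f N (of_real r * z))
         + 2 * L2_sq (\<lambda>z. taylor_poly f N (of_real r * z) - F z)"
        by (rule L2_sq_diff_le[OF hardy_dilate_L2[OF f] pd FL])
      also have "L2_sq (\<lambda>z. taylor_poly f N (of_real r * z) - F z)
        \<le> 2 * L2_sq (\<lambda>z. taylor_poly f N (of_real r * z) - taylor_poly f N z)
         + 2 * L2_sq (\<lambda>z. taylor_poly f N z - F z)"
        by (rule L2_sq_diff_le[OF pd taylor_poly_L2 FL])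
      finally have "L2_sq (\<lambda>z. f (of_real r * z) - F z) \<le> 2 * T N
         + 2 * (2 * L2_sq (\<lambda>z. taylor_poly f N (of_real r * z) - taylor_poly f N z)
         + 2 * L2_sq (\<lambda>z. taylor_poly f N z - F z))"
        using tail[of r N] elim(2) by simp
      moreover have "2 * t + 2 * (2 * x + 2 * y) < e" if "t < e/8" "x < e/16" "y < e/16" for t x y :: real
        using that e by simp
      ultimately have "L2_sq (\<lambda>z. f (of_real r * z) - F z) < e"
        using N elim(1) by (meson le_less_trans)
      then show ?case by (simp add: dist_real_def)
    qed
  qed
  then show ?thesis using FL by (simp add: is_boundary_def)
qed

text \<open>Both notions are limits in the mean, so they determine the boundary function up to a null set,
  and a boundary function in the one sense exists that is also one in the other sense.\<close>
lemma trace_iff_is_boundary: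
  assumes f: "f \<in> hardy2"
  shows "has_trace f F \<longleftrightarrow> is_boundary f F"
proof
  assume B: "is_boundary f F"
  obtain G where G: "has_trace f G" using trace_exists[OF f] .
  have "AE z in circle_measure. G z = F z"
  proof (rule L2_tendsto_unique)
    show "L2_tendsto (\<lambda>r::real. \<lambda>z. f (of_real r * z)) G (at_left 1)"
      using trace_imp_is_boundary[OF G] by (simp add: is_boundary_def L2_tendsto_def)
    show "L2_tendsto (\<lambda>r::real. \<lambda>z. f (of_real r * z)) F (at_left 1)"
      using B by (simp add: is_boundary_def L2_tendsto_def)
  qed (use B trace_L2[OF G] hardy_dilate_L2[OF f] in \<open>auto simp: is_boundary_def\<close>)
  then show "has_trace f F" using G B by (auto simp: is_boundary_def intro: trace_cong_AE)
qed (rule trace_imp_is_boundary)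

text \<open>This is the only fact about the choice made by \<^const>\<open>boundary\<close> that is ever needed.\<close>
lemma trace_boundary:
  assumes "f \<in> hardy2" shows "has_trace f (boundary f)"
proof -
  obtain G where "has_trace f G" using trace_exists[OF assms] .
  then have "is_boundary f (boundary f)"
    unfolding boundary_def by (metis someI trace_imp_is_boundary)
  then show ?thesis using trace_iff_is_boundary[OF assms] by simp
qed

lemma trace_scale:
  assumes "has_trace f F" shows "has_trace (\<lambda>z. c * f z) (\<lambda>z. c * F z)"
proof -
  have f: "f \<in> hardy2" using assms by (rule trace_hardy)
  have "taylor_poly (\<lambda>z. c * f z) N z - c * F z = c * (taylor_poly f N z - F z)" for N z
    by (simp add: taylor_poly_def taylor_coeff_scale[OF f] sum_distrib_left ring_distribs mult.assoc)
  then have "L2_sq (\<lambda>z. taylor_poly (\<lambda>z. c * f z) N z - c * F z)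
      = (norm c)\<^sup>2 * L2_sq (\<lambda>z. taylor_poly f N z - F z)" for N
    by (simp add: norm_mult power_mult_distrib)
  then have "L2_tendsto (taylor_poly (\<lambda>z. c * f z)) (\<lambda>z. c * F z) sequentially"
    using assms unfolding has_trace_def L2_tendsto_def by (auto intro: tendsto_mult_right_zero)
  then show ?thesis using assms by (auto simp: has_trace_def intro: hardy_scale L2_scale)
qed

lemma trace_add:
  assumes "has_trace f F" "has_trace g G"
  shows "has_trace (\<lambda>z. f z + g z) (\<lambda>z. F z + G z)"
  using trace_diff[OF assms(1) trace_scale[OF assms(2), of "-1"]] by simp

section \<open>Geometry of the Hardy space\<close>

lemma hardy_inner_self: "f \<in> hardy2 \<Longrightarrow> hardy_inner f f = of_real ((hardy_norm f)\<^sup>2)"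
  using trace_inner[of f "boundary f" f "boundary f"] trace_L2_sq[of f "boundary f"]
  by (simp add: trace_boundary L2_inner_self hardy_norm_def suminf_nonneg[OF hardy_summable])

lemma hardy_norm_eq_trace: "has_trace f F \<Longrightarrow> hardy_norm f = sqrt (L2_sq F)"
  by (simp add: hardy_norm_def trace_L2_sq)

lemma hardy_inner_add_left:
  "f \<in> hardy2 \<Longrightarrow> g \<in> hardy2 \<Longrightarrow> k \<in> hardy2 \<Longrightarrow>
    hardy_inner (\<lambda>z. f z + g z) k = hardy_inner f k + hardy_inner g k"
  using trace_inner[OF trace_add[OF trace_boundary[of f] trace_boundary[of g]] trace_boundary[of k]]
  by (simp add: trace_inner[OF trace_boundary trace_boundary] L2_inner_add_left trace_L2[OF trace_boundary])

lemma hardy_inner_diff_left: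
  "f \<in> hardy2 \<Longrightarrow> g \<in> hardy2 \<Longrightarrow> k \<in> hardy2 \<Longrightarrow>
    hardy_inner (\<lambda>z. f z - g z) k = hardy_inner f k - hardy_inner g k"
  using trace_inner[OF trace_diff[OF trace_boundary[of f] trace_boundary[of g]] trace_boundary[of k]]
  by (simp add: trace_inner[OF trace_boundary trace_boundary] L2_inner_diff_left trace_L2[OF trace_boundary])

lemma hardy_inner_scale_left:
  "f \<in> hardy2 \<Longrightarrow> k \<in> hardy2 \<Longrightarrow> hardy_inner (\<lambda>z. c * f z) k = c * hardy_inner f k"
  using trace_inner[OF trace_scale[OF trace_boundary[of f]] trace_boundary[of k]]
  by (simp add: trace_inner[OF trace_boundary trace_boundary] L2_inner_scale_left)

lemma hardy_inner_commute: "f \<in> hardy2 \<Longrightarrow> g \<in> hardy2 \<Longrightarrow> hardy_inner f g = cnj (hardy_inner g f)"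
  using L2_inner_commute[of "boundary f" "boundary g"]
  by (simp add: trace_inner[OF trace_boundary trace_boundary])

lemma hardy_inner_scale_right:
  "f \<in> hardy2 \<Longrightarrow> k \<in> hardy2 \<Longrightarrow> hardy_inner k (\<lambda>z. c * f z) = cnj c * hardy_inner k f"
  using hardy_inner_commute[of k "\<lambda>z. c * f z"] hardy_inner_commute[of k f]
  by (simp add: hardy_scale hardy_inner_scale_left)

lemma hardy_Cauchy_Schwarz:
  assumes "f \<in> hardy2" "g \<in> hardy2"
  shows "norm (hardy_inner f g) \<le> hardy_norm f * hardy_norm g"
proof -
  have "(norm (hardy_inner f g))\<^sup>2 \<le> L2_sq (boundary f) * L2_sq (boundary g)"
    using assms trace_inner[of f "boundary f" g "boundary g"]
    by (simp add: trace_boundary L2_Cauchy_Schwarz[OF trace_L2[OF trace_boundary] trace_L2[OF trace_boundary]])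
  then have "norm (hardy_inner f g) \<le> sqrt (L2_sq (boundary f) * L2_sq (boundary g))"
    by (rule real_le_rsqrt)
  then show ?thesis using assms by (simp add: hardy_norm_eq_trace[OF trace_boundary] real_sqrt_mult)
qed

lemma hardy_norm_nonneg: "f \<in> hardy2 \<Longrightarrow> 0 \<le> hardy_norm f"
  by (simp add: hardy_norm_def suminf_nonneg[OF hardy_summable])

lemma hardy_norm_eq_0:
  assumes f: "f \<in> hardy2" and 0: "hardy_norm f = 0"
  shows "f = (\<lambda>z. 0)"
proof -
  have "(norm (taylor_coeff f n))\<^sup>2 = 0" for n
    using suminf_eq_zero_iff[OF hardy_summable[OF f]] 0 by (simp add: hardy_norm_def)
  then have "taylor_coeff f = (\<lambda>n. 0)" by auto
  then have "hardy_of (taylor_coeff f) = (\<lambda>z. 0)" by (auto simp: hardy_of_def fun_eq_iff)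
  then show ?thesis by (simp add: hardy_of_taylor_coeff[OF f])
qed

section \<open>The Szego projection\<close>

text \<open>Bessel's inequality for the monomials, from the Cauchy--Schwarz inequality applied to \<open>G\<close> and the
  partial sum of its Fourier series.\<close>
lemma Bessel:
  assumes G: "G \<in> L2_circle"
  shows Bessel_summable: "summable (\<lambda>n. (norm (L2_inner G (\<lambda>z. z ^ n)))\<^sup>2)"
    and Bessel_le: "(\<Sum>n. (norm (L2_inner G (\<lambda>z. z ^ n)))\<^sup>2) \<le> L2_sq G"
proof -
  define b where "b n = L2_inner G (\<lambda>z. z ^ n)" for n
  have le: "(\<Sum>n<N. (norm (b n))\<^sup>2) \<le> L2_sq G" for N
  proof -
    define s where "s = (\<Sum>n<N. (norm (b n))\<^sup>2)"
    let ?p = "\<lambda>z. \<Sum>n<N. b n * z ^ n"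
    have p: "?p \<in> L2_circle"
      by (intro disk_algebra_L2 disk_algebra_sum disk_algebra_mult disk_algebra_const monomial_disk_algebra)
    have "L2_inner G ?p = (\<Sum>n<N. cnj (b n) * b n)"
      unfolding b_def by (rule L2_inner_sum_right) (auto intro: monomial_L2 G)
    also have "\<dots> = of_real s" by (simp add: s_def complex_norm_square mult.commute del: of_real_power)
    finally have ip: "L2_inner G ?p = of_real s" .
    have "L2_sq ?p = s" unfolding s_def by (rule L2_sq_trig_polynomial) simp
    then have "s\<^sup>2 \<le> L2_sq G * s"
      using L2_Cauchy_Schwarz[OF G p] unfolding ip by simp
    moreover have "s \<ge> 0" by (auto simp: s_def intro: sum_nonneg)
    ultimately show ?thesis unfolding s_def[symmetric]
      by (cases "s = 0") (auto simp: power2_eq_square)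
  qed
  show sm: "summable (\<lambda>n. (norm (b n))\<^sup>2)"
    by (rule bounded_imp_summable[of _ "L2_sq G"]) (use le[of "Suc _"] in \<open>auto simp: lessThan_Suc_atMost\<close>)
  show "(\<Sum>n. (norm (b n))\<^sup>2) \<le> L2_sq G"
    by (rule suminf_le_const[OF sm le])
qed

text \<open>The function whose Taylor coefficients are the Fourier coefficients of \<open>G\<close> with non-negative index
  represents the functional \<open>k \<mapsto> \<langle>G, k\<rangle>\<close>; it suffices to pair with Taylor polynomials of \<open>k\<close>.\<close>
lemma szego_inner:
  assumes G: "G \<in> L2_circle" and K: "has_trace k K"
  shows "hardy_inner (hardy_of (\<lambda>n. L2_inner G (\<lambda>z. z ^ n))) k = L2_inner G K"
proof -
  have "(\<lambda>N. cnj (L2_inner (taylor_poly k N) G)) \<longlonglongrightarrow> cnj (L2_inner K G)"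
    by (intro tendsto_cnj trace_inner_tendsto K G)
  moreover have "cnj (L2_inner (taylor_poly k N) G)
      = (\<Sum>n<N. L2_inner G (\<lambda>z. z ^ n) * cnj (taylor_coeff k n))" for N
    unfolding L2_inner_commute[of G, symmetric] taylor_poly_def[abs_def]
    by (subst L2_inner_sum_right) (auto intro: monomial_L2 G simp: mult.commute)
  ultimately have "(\<lambda>n. L2_inner G (\<lambda>z. z ^ n) * cnj (taylor_coeff k n)) sums L2_inner G K"
    unfolding sums_def L2_inner_commute[of G K] by simp
  then show ?thesis
    unfolding hardy_inner_def taylor_coeff_hardy_of[OF Bessel_summable[OF G]] by (simp add: sums_iff)
qed

text \<open>Existence in the definite description comes from the previous lemma. Uniqueness holds because two
  candidates have the same inner product with every element, in particular with their difference.\<close>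
lemma szego_proj_eq:
  assumes G: "G \<in> L2_circle"
  shows "szego_proj G = hardy_of (\<lambda>n. L2_inner G (\<lambda>z. z ^ n))"
  unfolding szego_proj_def
proof (rule the_equality)
  let ?h = "hardy_of (\<lambda>n. L2_inner G (\<lambda>z. z ^ n))"
  have h: "?h \<in> hardy2" by (intro hardy_of_in_hardy2 Bessel_summable G)
  have orth: "L2_inner (\<lambda>z. G z - boundary ?h z) (boundary k) = 0" if k: "k \<in> hardy2" for k
    using szego_inner[OF G trace_boundary[OF k]] trace_inner[OF trace_boundary[OF h] trace_boundary[OF k]]
    by (subst L2_inner_diff_left) (auto intro: G trace_L2 trace_boundary h k)
  show "?h \<in> hardy2 \<and> (\<forall>k\<in>hardy2. L2_inner (\<lambda>z. G z - boundary ?h z) (boundary k) = 0)"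
    using h orth by blast
  fix g assume g: "g \<in> hardy2 \<and> (\<forall>k\<in>hardy2. L2_inner (\<lambda>z. G z - boundary g z) (boundary k) = 0)"
  have gk: "hardy_inner g k = hardy_inner ?h k" if k: "k \<in> hardy2" for k
  proof -
    have "L2_inner (\<lambda>z. G z - boundary g z) (boundary k) = 0" using g k by blast
    then show ?thesis
      using szego_inner[OF G trace_boundary[OF k]] trace_inner[OF trace_boundary trace_boundary[OF k], of g] g
      by (subst (asm) L2_inner_diff_left) (auto intro: G trace_L2 trace_boundary k)
  qed
  have gh: "(\<lambda>z. g z - ?h z) \<in> hardy2" using g h by (intro hardy_diff) auto
  then have "hardy_inner (\<lambda>z. g z - ?h z) (\<lambda>z. g z - ?h z) = 0"
    using g h gk[OF gh] by (subst hardy_inner_diff_left) auto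
  then have "hardy_norm (\<lambda>z. g z - ?h z) = 0" using hardy_inner_self[OF gh] by simp
  from hardy_norm_eq_0[OF gh this] show "g = ?h" by (auto simp: fun_eq_iff)
qed

lemma
  assumes G: "G \<in> L2_circle"
  shows szego_proj_hardy: "szego_proj G \<in> hardy2"
    and taylor_coeff_szego_proj: "taylor_coeff (szego_proj G) n = L2_inner G (\<lambda>z. z ^ n)"
    and hardy_norm_szego_proj_le: "hardy_norm (szego_proj G) \<le> sqrt (L2_sq G)"
  using hardy_of_in_hardy2[OF Bessel_summable[OF G]] taylor_coeff_hardy_of[OF Bessel_summable[OF G]]
    Bessel_le[OF G]
  by (auto simp: szego_proj_eq[OF G] hardy_norm_def)

lemma szego_proj_inner:
  "G \<in> L2_circle \<Longrightarrow> has_trace k K \<Longrightarrow> hardy_inner (szego_proj G) k = L2_inner G K"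
  by (simp add: szego_proj_eq szego_inner)

section \<open>Recognising boundary functions\<close>

text \<open>Point evaluations are continuous. The constant is far from optimal; it comes from bounding each
  coefficient by the norm.\<close>
lemma norm_hardy_le:
  assumes f: "f \<in> hardy2" and z: "norm z < 1"
  shows "norm (f z) \<le> hardy_norm f / (1 - norm z)"
proof -
  have g: "(\<lambda>n. hardy_norm f * norm z ^ n) sums (hardy_norm f * (1 / (1 - norm z)))"
    using z by (intro sums_mult geometric_sums) auto
  have "norm (\<Sum>n. taylor_coeff f n * z ^ n) \<le> (\<Sum>n. hardy_norm f * norm z ^ n)"
    using square_summable_bounded[OF hardy_summable[OF f]]
    by (intro norm_suminf_le sums_summable[OF g])
       (auto simp: norm_mult norm_power hardy_norm_def intro!: mult_right_mono)
  then show ?thesis using hardy_sums[OF f z] g by (simp add: sums_iff)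
qed

text \<open>The radial limits exist everywhere on the circle and are dominated, so the dilates converge in the
  mean to the function itself.\<close>
lemma trace_disk_algebra:
  assumes p: "p \<in> disk_algebra"
  shows "has_trace (\<lambda>z. if norm z < 1 then p z else 0) p"
proof -
  let ?f = "\<lambda>z. if norm z < 1 then p z else 0"
  have [measurable]: "p \<in> borel_measurable borel" and cont: "continuous_on (cball 0 1) p"
    and hol: "p holomorphic_on ball 0 1" using p by (auto simp: disk_algebra_def)
  have coeff: "taylor_coeff ?f = taylor_coeff p"
  proof (rule taylor_coeff_eqI)
    fix z :: complex assume "norm z < 1"
    then show "(\<lambda>n. taylor_coeff p n * z ^ n) sums (if norm z < 1 then p z else 0)"
      using holomorphic_power_series[OF hol, of z] by (simp add: taylor_coeff_def)
  qed
  have "?f holomorphic_on ball 0 1" using hol by (subst holomorphic_cong[OF refl, of _ _ p]) auto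
  then have f: "?f \<in> hardy2"
    using Bessel_summable[OF disk_algebra_L2[OF p]] L2_inner_monomial[OF p]
    unfolding hardy2_def mem_Collect_eq coeff by simp
  have [measurable]: "?f \<in> borel_measurable borel" by (rule hardy_measurable[OF f])
  obtain K where K: "\<And>z. norm z \<le> 1 \<Longrightarrow> norm (p z) \<le> K" using disk_algebra_bounded[OF p] by blast
  \<comment> \<open>dominated convergence is applied along a sequence of radii that increases to \<open>1\<close>\<close>
  define r :: "nat \<Rightarrow> real" where "r j = 1 - 1 / (real j + 2)" for j
  have r: "0 < r j" "r j < 1" for j by (auto simp: r_def field_simps)
  have r_lim: "r \<longlonglongrightarrow> 1" unfolding r_def by real_asymp
  then have r_filt: "filterlim r (at_left 1) sequentially"
    using r by (auto simp: filterlim_at intro!: always_eventually less_imp_neq)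
  have "(\<lambda>j. L2_sq (\<lambda>z. ?f (of_real (r j) * z) - p z)) \<longlonglongrightarrow> (LINT z|circle_measure. 0)"
  proof (rule integral_dominated_convergence)
    show "AE z in circle_measure. (\<lambda>j. (norm (?f (of_real (r j) * z) - p z))\<^sup>2) \<longlonglongrightarrow> 0"
      using AE_circle_measure
    proof eventually_elim
      case (elim z)
      have "(\<lambda>j. p (of_real (r j) * z)) \<longlonglongrightarrow> p (of_real 1 * z)"
      proof (rule continuous_on_tendsto_compose[OF cont])
        show "(\<lambda>j. of_real (r j) * z) \<longlonglongrightarrow> of_real 1 * z" by (intro tendsto_intros r_lim)
        show "\<forall>\<^sub>F j in sequentially. of_real (r j) * z \<in> cball 0 1"
          using r elim by (intro always_eventually allI) (auto simp: norm_mult less_imp_le)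
      qed (use elim in auto)
      moreover have "?f (of_real (r j) * z) = p (of_real (r j) * z)" for j
        using r[of j] elim by (simp add: norm_mult)
      ultimately have "(\<lambda>j. (norm (?f (of_real (r j) * z) - p z))\<^sup>2) \<longlonglongrightarrow> (norm (p (of_real 1 * z) - p z))\<^sup>2"
        by (intro tendsto_intros) simp
      then show ?case by simp
    qed
    show "AE z in circle_measure. norm ((norm (?f (of_real (r j) * z) - p z))\<^sup>2) \<le> (K + K)\<^sup>2" for j
      using AE_circle_measure
    proof eventually_elim
      case (elim z)
      have "norm (?f (of_real (r j) * z) - p z) \<le> norm (?f (of_real (r j) * z)) + norm (p z)"
        by (rule norm_triangle_ineq4)
      also have "\<dots> \<le> K + K" using r[of j] elim by (intro add_mono) (auto simp: norm_mult intro!: K)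
      finally have "(norm (?f (of_real (r j) * z) - p z))\<^sup>2 \<le> (K + K)\<^sup>2" by (intro power_mono) auto
      then show ?case by (simp only: real_norm_def abs_power2)
    qed
  qed auto
  then have 1: "L2_tendsto (\<lambda>j z. ?f (of_real (r j) * z)) p sequentially"
    by (simp add: L2_tendsto_def)
  obtain F where F: "has_trace ?f F" using trace_exists[OF f] .
  then have "L2_tendsto (\<lambda>j z. ?f (of_real (r j) * z)) F sequentially"
    using trace_imp_is_boundary[OF F] filterlim_compose[OF _ r_filt] unfolding is_boundary_def L2_tendsto_def by blast
  from L2_tendsto_unique[OF this 1 _ hardy_dilate_L2[OF f] trace_L2[OF F] disk_algebra_L2[OF p]]
  have "AE z in circle_measure. F z = p z" by simp
  then show ?thesis by (rule trace_cong_AE[OF F disk_algebra_L2[OF p]])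
qed

text \<open>The device by which functions are recognised as elements of the Hardy space: a limit of disk
  algebra functions, pointwise in the disk and in the mean on the circle, has the mean limit as its
  boundary function. The proof projects the mean limit \<open>F\<close> to \<open>h\<close>. The Taylor coefficients of
  \<open>h - p n\<close> are Fourier coefficients of \<open>F - p n\<close>, so Bessel's inequality shows that \<open>p n\<close> tends to
  \<open>h\<close> in the Hardy norm, and hence also pointwise.\<close>
lemma trace_limit:
  assumes p: "\<And>n. p n \<in> disk_algebra" and F: "F \<in> L2_circle" and lim: "L2_tendsto p F sequentially"
    and ptw: "\<And>z. norm z < 1 \<Longrightarrow> (\<lambda>n. p n z) \<longlonglongrightarrow> f z" and out: "\<And>z. \<not> norm z < 1 \<Longrightarrow> f z = 0"
  shows "has_trace f F"
proof -
  define h where "h = szego_proj F"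
  have h: "h \<in> hardy2" unfolding h_def by (rule szego_proj_hardy[OF F])
  obtain H where H: "has_trace h H" using trace_exists[OF h] .
  let ?q = "\<lambda>n z. if norm z < 1 then p n z else 0"
  have d: "has_trace (\<lambda>z. h z - ?q n z) (\<lambda>z. H z - p n z)" for n
    by (intro trace_diff H trace_disk_algebra p)
  have le: "L2_sq (\<lambda>z. H z - p n z) \<le> L2_sq (\<lambda>z. p n z - F z)" for n
  proof -
    have "taylor_coeff (\<lambda>z. h z - ?q n z) k = L2_inner (\<lambda>z. F z - p n z) (\<lambda>z. z ^ k)" for k
    proof -
      have "taylor_coeff (?q n) k = L2_inner (p n) (\<lambda>z. z ^ k)"
        by (rule trace_coeff[symmetric, OF trace_disk_algebra[OF p]])
      then show ?thesis
        unfolding taylor_coeff_diff[OF h trace_hardy[OF trace_disk_algebra[OF p]]]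
        by (simp add: h_def taylor_coeff_szego_proj[OF F] L2_inner_diff_left[OF F disk_algebra_L2[OF p] monomial_L2])
    qed
    then have "L2_sq (\<lambda>z. H z - p n z) \<le> L2_sq (\<lambda>z. F z - p n z)"
      using trace_L2_sq[OF d[of n]] Bessel_le[OF L2_diff[OF F disk_algebra_L2[OF p[of n]]]] by simp
    then show ?thesis using L2_sq_commute[of F "p n"] by simp
  qed
  have "L2_tendsto p H sequentially" unfolding L2_tendsto_def
  proof (rule tendsto_sandwich[OF _ _ tendsto_const L2_tendsto_D[OF lim]])
    show "\<forall>\<^sub>F n in sequentially. L2_sq (\<lambda>z. p n z - H z) \<le> L2_sq (\<lambda>z. p n z - F z)"
      using le by (subst L2_sq_commute) auto
  qed auto
  from L2_tendsto_unique[OF this lim _ disk_algebra_L2[OF p] trace_L2[OF H] F]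
  have "AE z in circle_measure. H z = F z" by simp
  then have "has_trace h F" by (rule trace_cong_AE[OF H F])
  moreover have "h z = f z" for z
  proof (cases "norm z < 1")
    case True
    have "(\<lambda>n. sqrt (L2_sq (\<lambda>z. p n z - F z)) / (1 - norm z)) \<longlonglongrightarrow> sqrt 0 / (1 - norm z)"
      using True by (intro tendsto_intros L2_tendsto_D[OF lim]) auto
    then have l0: "(\<lambda>n. sqrt (L2_sq (\<lambda>z. p n z - F z)) / (1 - norm z)) \<longlonglongrightarrow> 0" by simp
    have "(\<lambda>n. h z - p n z) \<longlonglongrightarrow> 0"
    proof (rule tendsto_0_le[OF l0, of _ 1], intro always_eventually allI)
      fix n
      have "norm (h z - p n z) \<le> hardy_norm (\<lambda>z. h z - ?q n z) / (1 - norm z)"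
        using norm_hardy_le[OF trace_hardy[OF d[of n]] True] True by simp
      also have "\<dots> = sqrt (L2_sq (\<lambda>z. H z - p n z)) / (1 - norm z)"
        by (simp add: hardy_norm_eq_trace[OF d])
      also have "\<dots> \<le> sqrt (L2_sq (\<lambda>z. p n z - F z)) / (1 - norm z)"
        using True le[of n] by (intro divide_right_mono real_sqrt_le_mono) auto
      finally show "norm (h z - p n z) \<le> norm (sqrt (L2_sq (\<lambda>z. p n z - F z)) / (1 - norm z)) * 1"
        using True by simp
    qed
    from tendsto_diff[OF tendsto_const this, of "h z"] have "(\<lambda>n. p n z) \<longlonglongrightarrow> h z" by simp
    then show ?thesis using ptw[OF True] LIMSEQ_unique by blast
  next
    case False
    then show ?thesis using hardy_outside[OF h] out by simp
  qed
  then have "h = f" by (rule ext)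
  ultimately show ?thesis by simp
qed

lemma L2_tendsto_mult_bounded:
  assumes h: "h \<in> borel_measurable borel" "\<And>z. norm z = 1 \<Longrightarrow> norm (h z) \<le> K"
    and F: "\<And>n. F n \<in> L2_circle" "G \<in> L2_circle" "L2_tendsto F G A"
  shows "L2_tendsto (\<lambda>n z. h z * F n z) (\<lambda>z. h z * G z) A"
  unfolding L2_tendsto_def
proof (rule tendsto_sandwich[OF _ _ tendsto_const])
  show "\<forall>\<^sub>F n in A. L2_sq (\<lambda>z. h z * F n z - h z * G z) \<le> K\<^sup>2 * L2_sq (\<lambda>z. F n z - G z)"
    unfolding right_diff_distrib[symmetric]
    by (intro always_eventually allI L2_sq_mult_le h L2_diff F)
  show "((\<lambda>n. K\<^sup>2 * L2_sq (\<lambda>z. F n z - G z)) \<longlongrightarrow> 0) A"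
    by (intro tendsto_mult_right_zero L2_tendsto_D F)
qed auto

text \<open>Multiply the Taylor polynomials of \<open>f\<close> by \<open>q\<close> and pass to the limit.\<close>
lemma trace_mult:
  assumes F: "has_trace f F" and q: "q \<in> disk_algebra"
  shows "has_trace (\<lambda>z. q z * f z) (\<lambda>z. q z * F z)"
proof -
  obtain K where K: "\<And>z. norm z \<le> 1 \<Longrightarrow> norm (q z) \<le> K" using disk_algebra_bounded[OF q] by blast
  have [measurable]: "q \<in> borel_measurable borel" using q by (simp add: disk_algebra_def)
  show ?thesis
  proof (rule trace_limit)
    show "(\<lambda>z. q z * taylor_poly f n z) \<in> disk_algebra" for n
      by (intro disk_algebra_mult q taylor_poly_disk_algebra)
    show "(\<lambda>z. q z * F z) \<in> L2_circle"
      by (rule L2_mult_bounded(1)[of q F K]) (auto intro: trace_L2[OF F] K)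
    show "L2_tendsto (\<lambda>n z. q z * taylor_poly f n z) (\<lambda>z. q z * F z) sequentially"
      using F by (intro L2_tendsto_mult_bounded[of q K] taylor_poly_L2) (auto simp: has_trace_def intro: K)
    show "(\<lambda>n. q z * taylor_poly f n z) \<longlonglongrightarrow> q z * f z" if "norm z < 1" for z
      using hardy_sums[OF trace_hardy[OF F] that]
      unfolding sums_def taylor_poly_def by (intro tendsto_intros)
    show "q z * f z = 0" if "\<not> norm z < 1" for z
      using hardy_outside[OF trace_hardy[OF F] that] by simp
  qed
qed

section \<open>The disk automorphism and the Poisson kernel\<close>

lemma one_minus_cnj_mult_nz:
  assumes "norm a < 1" "norm z \<le> 1" shows "1 - cnj a * z \<noteq> 0"
proof
  assume "1 - cnj a * z = 0"
  then have "norm (cnj a * z) = 1" by simp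
  moreover have "norm (cnj a * z) \<le> norm a * 1"
    unfolding norm_mult complex_mod_cnj using assms by (intro mult_left_mono) auto
  ultimately show False using assms by simp
qed

lemma norm_disk_aut_identity:
  "(norm (1 - cnj a * z))\<^sup>2 - (norm (a - z))\<^sup>2 = (1 - (norm a)\<^sup>2) * (1 - (norm z)\<^sup>2)"
proof -
  have "complex_of_real ((norm (1 - cnj a * z))\<^sup>2 - (norm (a - z))\<^sup>2)
      = of_real ((1 - (norm a)\<^sup>2) * (1 - (norm z)\<^sup>2))"
    by (simp add: complex_norm_square algebra_simps del: of_real_power)
  then show ?thesis using of_real_eq_iff by blast
qed

lemma disk_aut_norm:
  assumes a: "norm a < 1"
  shows norm_disk_aut_eq_1: "norm z = 1 \<Longrightarrow> norm (disk_aut a z) = 1"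
    and norm_disk_aut_less_1: "norm z < 1 \<Longrightarrow> norm (disk_aut a z) < 1"
proof -
  have a2: "1 - (norm a)\<^sup>2 > 0" using a by (simp add: power_less_one_iff)
  show "norm (disk_aut a z) = 1" if z: "norm z = 1"
  proof -
    have "(norm (1 - cnj a * z))\<^sup>2 = (norm (a - z))\<^sup>2"
      using norm_disk_aut_identity[of a z] z by simp
    then have "norm (a - z) = norm (1 - cnj a * z)" by simp
    then show ?thesis using one_minus_cnj_mult_nz[OF a, of z] z
      by (simp only: disk_aut_def norm_divide) simp
  qed
  show "norm (disk_aut a z) < 1" if z: "norm z < 1"
  proof -
    have "1 - (norm z)\<^sup>2 > 0" using z by (simp add: power_less_one_iff)
    then have "(norm (a - z))\<^sup>2 < (norm (1 - cnj a * z))\<^sup>2"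
      using norm_disk_aut_identity[of a z] mult_pos_pos[OF a2 \<open>1 - (norm z)\<^sup>2 > 0\<close>] by linarith
    then have "norm (a - z) < norm (1 - cnj a * z)" by (rule power2_less_imp_less) simp
    then show ?thesis using one_minus_cnj_mult_nz[OF a, of z] z by (simp add: disk_aut_def norm_divide)
  qed
qed

lemma disk_aut_involution:
  assumes a: "norm a < 1" and z: "norm z < 1"
  shows "disk_aut a (disk_aut a z) = z"
proof -
  have 1: "1 - cnj a * z \<noteq> 0" using one_minus_cnj_mult_nz[OF a, of z] z by simp
  have 2: "1 - cnj a * a \<noteq> 0" using one_minus_cnj_mult_nz[OF a, of a] a by simp
  have "a - (a - z) / (1 - cnj a * z) = (1 - cnj a * a) * z / (1 - cnj a * z)"
    using 1 by (simp add: field_simps)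
  moreover have "1 - cnj a * ((a - z) / (1 - cnj a * z)) = (1 - cnj a * a) / (1 - cnj a * z)"
    using 1 by (simp add: field_simps)
  ultimately show ?thesis using 1 2 by (simp add: disk_aut_def)
qed

lemma disk_algebra_divide:
  assumes p: "p \<in> disk_algebra" and q: "q \<in> disk_algebra" and nz: "\<And>z. norm z \<le> 1 \<Longrightarrow> q z \<noteq> 0"
  shows "(\<lambda>z. p z / q z) \<in> disk_algebra"
proof -
  have [measurable]: "p \<in> borel_measurable borel" "q \<in> borel_measurable borel"
    using p q by (auto simp: disk_algebra_def)
  show ?thesis using p q nz
    by (auto simp: disk_algebra_def intro!: continuous_intros holomorphic_intros)
qed

lemma disk_algebra_affine: "(\<lambda>z. b - c * z) \<in> disk_algebra"
  by (intro disk_algebra_diff disk_algebra_mult disk_algebra_const disk_algebra_id)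

lemma disk_aut_disk_algebra:
  assumes "norm a < 1" shows "disk_aut a \<in> disk_algebra"
  unfolding disk_aut_def[abs_def]
  using disk_algebra_divide[OF disk_algebra_affine[of a 1] disk_algebra_affine[of 1 "cnj a"]]
    one_minus_cnj_mult_nz[OF assms] by simp

text \<open>The Poisson kernel of the point \<open>a\<close>: for \<open>\<bar>z\<bar> = 1\<close> the denominator equals \<open>\<bar>z - a\<bar>\<^sup>2\<close>.\<close>
definition poisson :: "complex \<Rightarrow> complex \<Rightarrow> complex" where
  "poisson a z = of_real ((1 - (norm a)\<^sup>2) / (norm (1 - cnj a * z))\<^sup>2)"

lemma poisson_measurable [measurable]: "poisson a \<in> borel_measurable borel"
  unfolding poisson_def[abs_def] by measurable

lemma poisson_bounded:
  assumes a: "norm a < 1" and z: "norm z = 1"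
  shows "norm (poisson a z) \<le> (1 - (norm a)\<^sup>2) / (1 - norm a)\<^sup>2"
proof -
  have "1 - norm a \<le> norm (1 - cnj a * z)"
    using norm_triangle_ineq2[of 1 "cnj a * z"] z by (simp add: norm_mult)
  then have "(1 - norm a)\<^sup>2 \<le> (norm (1 - cnj a * z))\<^sup>2" using a by (intro power_mono) auto
  moreover have "0 \<le> 1 - (norm a)\<^sup>2" using a by (simp add: power_le_one)
  ultimately show ?thesis unfolding poisson_def norm_of_real using a
    by (subst abs_of_nonneg) (auto intro!: frac_le divide_nonneg_nonneg)
qed

text \<open>On the circle the kernel is twice the real part of a geometric series, minus one, which separates it
  into an analytic and a coanalytic part.\<close>
lemma poisson_eq_geometric:
  assumes a: "norm a < 1" and z: "norm z = 1"
  shows "poisson a z = 1 / (1 - cnj a * z) + cnj (1 / (1 - cnj a * z)) - 1"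
proof -
  have nz: "1 - cnj a * z \<noteq> 0" using one_minus_cnj_mult_nz[OF a, of z] z by simp
  then have nz': "1 - a * cnj z \<noteq> 0"
    by (metis complex_cnj_cancel_iff complex_cnj_cnj complex_cnj_diff complex_cnj_mult complex_cnj_one complex_cnj_zero)
  have zz: "z * cnj z = 1" using z by (simp add: complex_norm_square[symmetric])
  have "complex_of_real ((norm (1 - cnj a * z))\<^sup>2) = (1 - cnj a * z) * (1 - a * cnj z)"
    by (simp add: complex_norm_square del: of_real_power)
  then have "poisson a z = (1 - a * cnj a) / ((1 - cnj a * z) * (1 - a * cnj z))"
    unfolding poisson_def of_real_divide by (simp add: complex_norm_square del: of_real_power)
  also have "1 - a * cnj a = (1 - a * cnj z) + (1 - cnj a * z) - (1 - cnj a * z) * (1 - a * cnj z)"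
    using zz by algebra
  also have "\<dots> / ((1 - cnj a * z) * (1 - a * cnj z)) = 1 / (1 - cnj a * z) + 1 / (1 - a * cnj z) - 1"
  proof -
    have "(y + x - x * y) / (x * y) = 1 / x + 1 / y - 1" if "x \<noteq> 0" "y \<noteq> 0" for x y :: complex
      using that by (simp add: field_simps)
    from this[OF nz nz'] show ?thesis .
  qed
  finally show ?thesis by simp
qed

text \<open>The kernel reproduces the value of \<open>z^k\<close> at \<open>a\<close>. By the preceding decomposition this reduces to
  the Taylor coefficients of \<open>1 / (1 - cnj a * z)\<close>.\<close>
lemma integral_poisson_power:
  assumes a: "norm a < 1"
  shows "(LINT z|circle_measure. poisson a z * z ^ k) = a ^ k"
proof -
  define u where "u z = 1 / (1 - cnj a * z)" for z
  have u: "u \<in> disk_algebra"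
    unfolding u_def[abs_def] using one_minus_cnj_mult_nz[OF a]
    by (intro disk_algebra_divide disk_algebra_const disk_algebra_affine)
  have [measurable]: "u \<in> borel_measurable borel" using u by (simp add: disk_algebra_def)
  have coeff: "taylor_coeff u = (\<lambda>n. cnj a ^ n)"
  proof (rule taylor_coeff_eqI)
    fix z :: complex assume z: "norm z < 1"
    have "norm (cnj a * z) \<le> norm a * 1"
      unfolding norm_mult complex_mod_cnj using z by (intro mult_left_mono) auto
    then have "norm (cnj a * z) < 1" using a by simp
    then show "(\<lambda>n. cnj a ^ n * z ^ n) sums u z"
      using geometric_sums[of "cnj a * z"] by (simp add: u_def power_mult_distrib)
  qed
  have uz: "(\<lambda>z. u z * z ^ k) \<in> disk_algebra" by (intro disk_algebra_mult u monomial_disk_algebra)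
  have 1: "(LINT z|circle_measure. u z * z ^ k) = 0 ^ k"
    using circle_integral_fourier[OF uz, of 0] by (simp add: taylor_coeff_def u_def)
  have 2: "(LINT z|circle_measure. z ^ k * cnj (u z)) = a ^ k"
  proof -
    have "L2_inner (\<lambda>z. z ^ k) u = a ^ k"
      by (subst L2_inner_commute) (simp add: L2_inner_monomial[OF u] coeff)
    then show ?thesis by (simp add: L2_inner_def)
  qed
  have 3: "(LINT z|circle_measure. z ^ k) = 0 ^ k"
    using circle_integral_fourier[OF monomial_disk_algebra[of k], of 0] by (simp add: taylor_coeff_def)
  have one: "(\<lambda>_. 1) \<in> L2_circle" by (intro disk_algebra_L2 disk_algebra_const)
  have i1: "integrable circle_measure (\<lambda>z. u z * z ^ k)"
    using L2_inner_integrable[OF disk_algebra_L2[OF uz] one] by simp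
  have i2: "integrable circle_measure (\<lambda>z. z ^ k * cnj (u z))"
    by (intro L2_inner_integrable monomial_L2 disk_algebra_L2 u)
  have i3: "integrable circle_measure (\<lambda>z. z ^ k)"
    using L2_inner_integrable[OF monomial_L2[of k] one] by simp
  have "(LINT z|circle_measure. poisson a z * z ^ k)
      = (LINT z|circle_measure. u z * z ^ k + z ^ k * cnj (u z) - z ^ k)"
  proof (rule integral_cong_AE)
    show "AE z in circle_measure. poisson a z * z ^ k = u z * z ^ k + z ^ k * cnj (u z) - z ^ k"
      using AE_circle_measure
      by eventually_elim (simp add: poisson_eq_geometric[OF a] u_def algebra_simps)
  qed measurable
  also have "\<dots> = 0 ^ k + a ^ k - 0 ^ k"
    using 1 2 3 i1 i2 i3 by simp
  finally show ?thesis by simp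
qed

lemma L2_poisson_mult:
  assumes "norm a < 1" "F \<in> L2_circle" shows "(\<lambda>z. poisson a z * F z) \<in> L2_circle"
  using assms by (intro L2_mult_bounded(1)[OF _ _ poisson_bounded[of a]]) auto

lemma L2_inner_real_symbol:
  assumes "\<And>z. cnj (h z) = h z"
  shows "L2_inner (\<lambda>z. h z * F z) G = cnj (L2_inner (\<lambda>z. h z * G z) F)"
  unfolding L2_inner_def Bochner_Integration.integral_cnj[symmetric]
  by (simp add: assms mult_ac)

text \<open>The change of variables under the automorphism \<open>\<phi>\<close>, for monomials, without any substitution in
  the integral. Let \<open>n = m + k\<close>. As \<open>\<phi>\<close> is unimodular on the circle, the left-hand side is the mean
  of \<open>\<phi>^k\<close>, which is \<open>\<phi> 0 ^ k = a ^ k\<close>; likewise the right-hand side is the mean of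
  \<open>poisson a z * z ^ k\<close>, which is \<open>a ^ k\<close> too. The case \<open>n < m\<close> follows by conjugation.\<close>
lemma disk_aut_monomial_inner:
  assumes a: "norm a < 1"
  shows "L2_inner (\<lambda>z. disk_aut a z ^ n) (\<lambda>z. disk_aut a z ^ m) = L2_inner (\<lambda>z. poisson a z * z ^ n) (\<lambda>z. z ^ m)"
proof -
  have phi: "disk_aut a \<in> disk_algebra" by (rule disk_aut_disk_algebra[OF a])
  have [measurable]: "disk_aut a \<in> borel_measurable borel" using phi by (simp add: disk_algebra_def)
  have pw: "w ^ (m + k) * cnj (w ^ m) = w ^ k" if "norm w = 1" for w :: complex and m k
  proof -
    have "w ^ m * cnj (w ^ m) = 1"
      using that complex_norm_square[of "w ^ m"] by (simp add: norm_power)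
    then show ?thesis unfolding power_add by (simp add: mult.commute mult.left_commute)
  qed
  have *: "L2_inner (\<lambda>z. disk_aut a z ^ (m + k)) (\<lambda>z. disk_aut a z ^ m)
      = L2_inner (\<lambda>z. poisson a z * z ^ (m + k)) (\<lambda>z. z ^ m)" for m k
  proof -
    have "L2_inner (\<lambda>z. disk_aut a z ^ (m + k)) (\<lambda>z. disk_aut a z ^ m) = (LINT z|circle_measure. disk_aut a z ^ k)"
      unfolding L2_inner_def
    proof (rule integral_cong_AE)
      show "AE z in circle_measure. disk_aut a z ^ (m + k) * cnj (disk_aut a z ^ m) = disk_aut a z ^ k"
        using AE_circle_measure by eventually_elim (intro pw norm_disk_aut_eq_1 a)
    qed measurable
    also have "\<dots> = a ^ k"
      using circle_integral_fourier[OF disk_algebra_power[OF phi, of k], of 0]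
      by (simp add: taylor_coeff_def disk_aut_def)
    also have "\<dots> = (LINT z|circle_measure. poisson a z * z ^ k)"
      by (rule integral_poisson_power[OF a, symmetric])
    also have "\<dots> = L2_inner (\<lambda>z. poisson a z * z ^ (m + k)) (\<lambda>z. z ^ m)"
      unfolding L2_inner_def
    proof (rule integral_cong_AE)
      show "AE z in circle_measure. poisson a z * z ^ k = poisson a z * z ^ (m + k) * cnj (z ^ m)"
        using AE_circle_measure by eventually_elim (use pw in \<open>simp add: mult.assoc\<close>)
    qed measurable
    finally show ?thesis .
  qed
  show ?thesis
  proof (cases "m \<le> n")
    case True
    then show ?thesis using *[of m "n - m"] by simp
  next
    case False
    have "L2_inner (\<lambda>z. disk_aut a z ^ n) (\<lambda>z. disk_aut a z ^ m)
        = cnj (L2_inner (\<lambda>z. poisson a z * z ^ m) (\<lambda>z. z ^ n))"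
      using *[of n "m - n"] False by (subst L2_inner_commute) simp
    also have "\<dots> = L2_inner (\<lambda>z. poisson a z * z ^ n) (\<lambda>z. z ^ m)"
      by (rule L2_inner_real_symbol[symmetric]) (simp add: poisson_def)
    finally show ?thesis .
  qed
qed

section \<open>Composition with the disk automorphism\<close>

lemma taylor_poly_disk_aut_inner:
  assumes a: "norm a < 1"
  shows "L2_inner (\<lambda>z. taylor_poly f M (disk_aut a z)) (\<lambda>z. taylor_poly g N (disk_aut a z))
       = L2_inner (\<lambda>z. poisson a z * taylor_poly f M z) (taylor_poly g N)"
proof -
  have phi: "(\<lambda>z. disk_aut a z ^ n) \<in> L2_circle" for n
    by (intro disk_algebra_L2 disk_algebra_power disk_aut_disk_algebra a)
  have "L2_inner (\<lambda>z. taylor_poly f M (disk_aut a z)) (\<lambda>z. taylor_poly g N (disk_aut a z))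
     = (\<Sum>i<M. taylor_coeff f i * (\<Sum>j<N. cnj (taylor_coeff g j) *
          L2_inner (\<lambda>z. disk_aut a z ^ i) (\<lambda>z. disk_aut a z ^ j)))"
    unfolding taylor_poly_def
    by (subst L2_inner_sum_left, rule phi, intro disk_algebra_L2 disk_algebra_sum disk_algebra_mult
        disk_algebra_const disk_algebra_power disk_aut_disk_algebra a, subst L2_inner_sum_right) (auto intro: phi)
  also have "\<dots> = (\<Sum>i<M. taylor_coeff f i * (\<Sum>j<N. cnj (taylor_coeff g j) *
          L2_inner (\<lambda>z. poisson a z * z ^ i) (\<lambda>z. z ^ j)))"
    by (simp add: disk_aut_monomial_inner[OF a])
  also have "\<dots> = L2_inner (\<lambda>z. \<Sum>i<M. taylor_coeff f i * (poisson a z * z ^ i)) (taylor_poly g N)"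
    unfolding taylor_poly_def[abs_def]
    by (subst L2_inner_sum_left, intro L2_poisson_mult a monomial_L2, intro disk_algebra_L2 disk_algebra_sum disk_algebra_mult
        disk_algebra_const monomial_disk_algebra, subst L2_inner_sum_right) (auto intro: L2_poisson_mult a monomial_L2)
  also have "(\<lambda>z. \<Sum>i<M. taylor_coeff f i * (poisson a z * z ^ i)) = (\<lambda>z. poisson a z * taylor_poly f M z)"
    by (simp add: taylor_poly_def sum_distrib_left mult_ac)
  finally show ?thesis .
qed

lemma taylor_poly_disk_aut_in_disk_algebra:
  assumes "norm a < 1" shows "(\<lambda>z. taylor_poly f N (disk_aut a z)) \<in> disk_algebra"
  unfolding taylor_poly_def
  by (intro disk_algebra_sum disk_algebra_mult disk_algebra_const disk_algebra_power disk_aut_disk_algebra assms)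

text \<open>The bound on the kernel makes composition with the automorphism bounded in the mean on
  polynomials; differences are expanded so that the identity for pairs of Taylor polynomials applies.\<close>
lemma L2_sq_taylor_poly_disk_aut_diff_le:
  assumes a: "norm a < 1"
  shows "L2_sq (\<lambda>z. taylor_poly f M (disk_aut a z) - taylor_poly f N (disk_aut a z))
    \<le> (1 - (norm a)\<^sup>2) / (1 - norm a)\<^sup>2 * L2_sq (\<lambda>z. taylor_poly f M z - taylor_poly f N z)"
proof -
  define K where "K = (1 - (norm a)\<^sup>2) / (1 - norm a)\<^sup>2"
  have K: "K \<ge> 0" using a by (simp add: K_def power_le_one)
  let ?A = "\<lambda>N z. taylor_poly f N (disk_aut a z)" and ?S = "taylor_poly f"
  let ?D = "\<lambda>z. ?S M z - ?S N z" and ?E = "\<lambda>z. ?A M z - ?A N z"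
  have A: "?A N \<in> L2_circle" for N by (intro disk_algebra_L2 taylor_poly_disk_aut_in_disk_algebra a)
  note S = taylor_poly_L2[of f]
  have D: "?D \<in> L2_circle" by (intro L2_diff S)
  have "L2_inner ?E ?E = L2_inner (\<lambda>z. poisson a z * ?S M z - poisson a z * ?S N z) ?D"
    by (simp add: L2_inner_diff_left L2_inner_diff_right A S L2_diff L2_poisson_mult[OF a]
        taylor_poly_disk_aut_inner[OF a])
  also have "\<dots> = L2_inner (\<lambda>z. poisson a z * ?D z) ?D" by (simp add: right_diff_distrib)
  finally have "norm (L2_inner ?E ?E) = norm (L2_inner (\<lambda>z. poisson a z * ?D z) ?D)" by simp
  moreover have "norm (L2_inner ?E ?E) = L2_sq ?E"
    unfolding L2_inner_self norm_of_real by (rule abs_of_nonneg[OF L2_sq_nonneg])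
  ultimately have "(L2_sq ?E)\<^sup>2 \<le> L2_sq (\<lambda>z. poisson a z * ?D z) * L2_sq ?D"
    using L2_Cauchy_Schwarz[OF L2_poisson_mult[OF a D] D] by simp
  also have "\<dots> \<le> K\<^sup>2 * L2_sq ?D * L2_sq ?D"
    unfolding K_def by (intro mult_right_mono L2_sq_mult_le poisson_bounded a D L2_sq_nonneg) auto
  also have "\<dots> = (K * L2_sq ?D)\<^sup>2" by (simp add: power2_eq_square)
  finally have "L2_sq ?E \<le> K * L2_sq ?D"
    using K by (intro power2_le_imp_le[of "L2_sq ?E"]) (auto intro: mult_nonneg_nonneg L2_sq_nonneg)
  then show ?thesis by (simp add: K_def)
qed

text \<open>The composed Taylor polynomials form a Cauchy sequence in the mean and converge pointwise in the
  disk to the composition, so the recognition principle for limits applies.\<close>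
lemma trace_comp_op:
  assumes a: "norm a < 1" and F: "has_trace f F"
  obtains G where "has_trace (comp_op a f) G" "L2_tendsto (\<lambda>N z. taylor_poly f N (disk_aut a z)) G sequentially"
proof -
  let ?A = "\<lambda>N z. taylor_poly f N (disk_aut a z)"
  define K where "K = (1 - (norm a)\<^sup>2) / (1 - norm a)\<^sup>2"
  have K: "K \<ge> 0" using a by (simp add: K_def power_le_one)
  have f: "f \<in> hardy2" by (rule trace_hardy[OF F])
  have A: "?A N \<in> disk_algebra" for N by (intro taylor_poly_disk_aut_in_disk_algebra a)
  have "\<exists>N. \<forall>m\<ge>N. \<forall>n\<ge>N. L2_sq (\<lambda>z. ?A m z - ?A n z) < e" if e: "e > 0" for e
  proof -
    have "\<forall>\<^sub>F N in sequentially. L2_sq (\<lambda>z. taylor_poly f N z - F z) < e / (K + 1) / 4"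
      using F e K unfolding has_trace_def L2_tendsto_def by (intro order_tendstoD(2)) auto
    then obtain N where N: "\<And>n. n \<ge> N \<Longrightarrow> L2_sq (\<lambda>z. taylor_poly f n z - F z) < e / (K + 1) / 4"
      by (auto simp: eventually_sequentially)
    have "L2_sq (\<lambda>z. ?A m z - ?A n z) < e" if mn: "m \<ge> N" "n \<ge> N" for m n
    proof -
      have "L2_sq (\<lambda>z. taylor_poly f m z - taylor_poly f n z)
        \<le> 2 * L2_sq (\<lambda>z. taylor_poly f m z - F z) + 2 * L2_sq (\<lambda>z. F z - taylor_poly f n z)"
        by (intro L2_sq_diff_le taylor_poly_L2 trace_L2[OF F])
      also have "\<dots> < 2 * (e / (K + 1) / 4) + 2 * (e / (K + 1) / 4)"
        using N[OF mn(1)] N[OF mn(2)] L2_sq_commute[of F "taylor_poly f n"] by simp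
      also have "\<dots> = e / (K + 1)"
      proof -
        have "2 * (t / 4) + 2 * (t / 4) = t" for t :: real by simp
        then show ?thesis .
      qed
      finally have d: "L2_sq (\<lambda>z. taylor_poly f m z - taylor_poly f n z) < e / (K + 1)" .
      have "L2_sq (\<lambda>z. ?A m z - ?A n z) \<le> K * L2_sq (\<lambda>z. taylor_poly f m z - taylor_poly f n z)"
        unfolding K_def by (rule L2_sq_taylor_poly_disk_aut_diff_le[OF a])
      also have "\<dots> \<le> K * (e / (K + 1))" using d K by (intro mult_left_mono) auto
      also have "\<dots> < e" using K e by (simp add: field_simps)
      finally show ?thesis .
    qed
    then show ?thesis by blast
  qed
  from L2_complete[OF disk_algebra_L2[OF A] this]
  obtain G where G: "G \<in> L2_circle" "L2_tendsto ?A G sequentially" by blast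
  have "has_trace (comp_op a f) G"
  proof (rule trace_limit[OF A G])
    show "(\<lambda>n. ?A n z) \<longlonglongrightarrow> comp_op a f z" if z: "norm z < 1" for z
      using hardy_sums[OF f norm_disk_aut_less_1[OF a z]] z
      by (simp add: sums_def taylor_poly_def comp_op_def)
  qed (simp add: comp_op_def)
  then show ?thesis using G(2) by (rule that)
qed

lemma comp_op_hardy:
  assumes "norm a < 1" "f \<in> hardy2" shows "comp_op a f \<in> hardy2"
  using trace_comp_op[OF assms(1) trace_boundary[OF assms(2)]] trace_hardy by blast

text \<open>In operator terms, \<open>C\<^sub>a\<^sup>* C\<^sub>a\<close> is the Toeplitz operator whose symbol is the Poisson kernel.\<close>
lemma comp_op_inner:
  assumes a: "norm a < 1" and F: "has_trace f F" and K: "has_trace k K"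
  shows "hardy_inner (comp_op a f) (comp_op a k) = L2_inner (\<lambda>z. poisson a z * F z) K"
proof -
  obtain F' where F': "has_trace (comp_op a f) F'" "L2_tendsto (\<lambda>N z. taylor_poly f N (disk_aut a z)) F' sequentially"
    by (rule trace_comp_op[OF a F])
  obtain K' where K': "has_trace (comp_op a k) K'" "L2_tendsto (\<lambda>N z. taylor_poly k N (disk_aut a z)) K' sequentially"
    by (rule trace_comp_op[OF a K])
  have A: "(\<lambda>z. taylor_poly g N (disk_aut a z)) \<in> L2_circle" for g N
    by (intro disk_algebra_L2 taylor_poly_disk_aut_in_disk_algebra a)
  have "(\<lambda>N. L2_inner (\<lambda>z. taylor_poly f N (disk_aut a z)) (\<lambda>z. taylor_poly k N (disk_aut a z)))
      \<longlonglongrightarrow> L2_inner F' K'"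
    by (intro L2_inner_tendsto F' K' A trace_L2[OF F'(1)] trace_L2[OF K'(1)])
  moreover have "(\<lambda>N. L2_inner (\<lambda>z. poisson a z * taylor_poly f N z) (taylor_poly k N))
      \<longlonglongrightarrow> L2_inner (\<lambda>z. poisson a z * F z) K"
    using F K
    by (intro L2_inner_tendsto L2_tendsto_mult_bounded[OF _ poisson_bounded[OF a]] L2_poisson_mult[OF a] taylor_poly_L2)
       (auto simp: has_trace_def)
  ultimately have "L2_inner F' K' = L2_inner (\<lambda>z. poisson a z * F z) K"
    unfolding taylor_poly_disk_aut_inner[OF a] by (rule LIMSEQ_unique)
  then show ?thesis by (simp add: trace_inner[OF F'(1) K'(1)])
qed

lemma comp_op_comp_op:
  assumes "norm a < 1" "f \<in> hardy2" shows "comp_op a (comp_op a f) = f"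
  using assms hardy_outside[of f]
  by (auto simp: fun_eq_iff comp_op_def norm_disk_aut_less_1 disk_aut_involution)

section \<open>Toeplitz operators\<close>

text \<open>Operators defined through the Szego projection are only accessible through inner products; this
  lemma turns such weak identities into equalities of functions.\<close>
lemma hardy_inner_extensional:
  assumes f: "f \<in> hardy2" and g: "g \<in> hardy2"
    and eq: "\<And>k. k \<in> hardy2 \<Longrightarrow> hardy_inner f k = hardy_inner g k"
  shows "f = g"
proof -
  let ?d = "\<lambda>z. f z - g z"
  have d: "?d \<in> hardy2" by (rule hardy_diff(1)[OF f g])
  have "hardy_inner ?d ?d = 0"
    using eq[OF d] by (simp add: hardy_inner_diff_left[OF f g d])
  then have "hardy_norm ?d = 0" by (simp add: hardy_inner_self[OF d])
  from hardy_norm_eq_0[OF d this] show ?thesis by (auto simp: fun_eq_iff)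
qed

context
  fixes \<psi> :: "complex \<Rightarrow> complex" and M :: real
  assumes meas [measurable]: "\<psi> \<in> borel_measurable borel"
    and bound: "\<And>z. norm z = 1 \<Longrightarrow> norm (\<psi> z) \<le> M"
begin

lemma toeplitz_hardy: "f \<in> hardy2 \<Longrightarrow> toeplitz \<psi> f \<in> hardy2"
  unfolding toeplitz_def
  by (intro szego_proj_hardy L2_mult_bounded(1)[OF meas _ bound] trace_L2[OF trace_boundary])

text \<open>Boundary functions of \<open>f\<close> agree almost everywhere, so each of them computes \<^const>\<open>toeplitz\<close>.\<close>
lemma toeplitz_inner:
  assumes F: "has_trace f F" and K: "has_trace k K"
  shows "hardy_inner (toeplitz \<psi> f) k = L2_inner (\<lambda>z. \<psi> z * F z) K"
proof -
  have B: "has_trace f (boundary f)" by (rule trace_boundary[OF trace_hardy[OF F]])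
  have L: "(\<lambda>z. \<psi> z * boundary f z) \<in> L2_circle" "(\<lambda>z. \<psi> z * F z) \<in> L2_circle"
    by (auto intro!: L2_mult_bounded(1)[OF meas _ bound] trace_L2[OF F] trace_L2[OF B])
  have "hardy_inner (toeplitz \<psi> f) k = L2_inner (\<lambda>z. \<psi> z * boundary f z) K"
    unfolding toeplitz_def by (rule szego_proj_inner[OF L(1) K])
  also have "\<dots> = L2_inner (\<lambda>z. \<psi> z * F z) K"
    using trace_unique[OF B F] by (intro L2_inner_cong_AE L trace_L2[OF K]) (auto elim!: eventually_mono)
  finally show ?thesis .
qed

lemma toeplitz_bounded_op: "bounded_op (toeplitz \<psi>)"
  unfolding bounded_op_def
proof (intro conjI ballI allI)
  fix f g c assume f: "f \<in> hardy2" and g: "g \<in> hardy2"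
  show "toeplitz \<psi> f \<in> hardy2" by (rule toeplitz_hardy[OF f])
  note tf = trace_boundary[OF f] and tg = trace_boundary[OF g]
  have L: "(\<lambda>z. \<psi> z * boundary f z) \<in> L2_circle" "(\<lambda>z. \<psi> z * boundary g z) \<in> L2_circle"
    by (auto intro!: L2_mult_bounded(1)[OF meas _ bound] trace_L2[OF tf] trace_L2[OF tg])
  show "toeplitz \<psi> (\<lambda>z. f z + g z) = (\<lambda>z. toeplitz \<psi> f z + toeplitz \<psi> g z)"
  proof (rule hardy_inner_extensional)
    fix k assume k: "k \<in> hardy2"
    note tk = trace_boundary[OF k]
    show "hardy_inner (toeplitz \<psi> (\<lambda>z. f z + g z)) k
        = hardy_inner (\<lambda>z. toeplitz \<psi> f z + toeplitz \<psi> g z) k"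
      by (simp add: hardy_inner_add_left toeplitz_hardy f g k toeplitz_inner[OF trace_add[OF tf tg] tk]
        toeplitz_inner[OF tf tk] toeplitz_inner[OF tg tk] ring_distribs L2_inner_add_left L trace_L2[OF tk])
  qed (intro toeplitz_hardy hardy_add f g)+
  show "toeplitz \<psi> (\<lambda>z. c * f z) = (\<lambda>z. c * toeplitz \<psi> f z)"
  proof (rule hardy_inner_extensional)
    fix k assume k: "k \<in> hardy2"
    note tk = trace_boundary[OF k]
    show "hardy_inner (toeplitz \<psi> (\<lambda>z. c * f z)) k = hardy_inner (\<lambda>z. c * toeplitz \<psi> f z) k"
      by (simp add: hardy_inner_scale_left toeplitz_hardy f k toeplitz_inner[OF trace_scale[OF tf] tk]
        toeplitz_inner[OF tf tk] L2_inner_scale_left mult.left_commute[of "\<psi> _"])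
  qed (intro toeplitz_hardy hardy_scale f)+
next
  show "\<exists>K. \<forall>f\<in>hardy2. hardy_norm (toeplitz \<psi> f) \<le> K * hardy_norm f"
  proof (intro exI ballI)
    fix f assume f: "f \<in> hardy2"
    note tf = trace_boundary[OF f]
    have "0 \<le> M" by (rule order_trans[OF norm_ge_zero bound[of 1]]) simp
    have L: "(\<lambda>z. \<psi> z * boundary f z) \<in> L2_circle"
      by (auto intro!: L2_mult_bounded(1)[OF meas _ bound] trace_L2[OF tf])
    have "hardy_norm (toeplitz \<psi> f) \<le> sqrt (L2_sq (\<lambda>z. \<psi> z * boundary f z))"
      unfolding toeplitz_def by (rule hardy_norm_szego_proj_le[OF L])
    also have "\<dots> \<le> sqrt (M\<^sup>2 * L2_sq (boundary f))"
      by (intro real_sqrt_le_mono L2_sq_mult_le meas bound trace_L2[OF tf])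
    also have "\<dots> = M * hardy_norm f"
      using \<open>0 \<le> M\<close> by (simp add: hardy_norm_eq_trace[OF tf] real_sqrt_mult)
    finally show "hardy_norm (toeplitz \<psi> f) \<le> M * hardy_norm f" .
  qed
qed

end

section \<open>The symbol \<open>1 + poisson a\<close>\<close>

lemma symbol_g_eq: "symbol_g a z = 1 + poisson a z"
  by (simp add: symbol_g_def poisson_def)

lemma symbol_g_measurable [measurable]: "symbol_g a \<in> borel_measurable borel"
  unfolding symbol_g_eq[abs_def] by measurable

lemma symbol_g_bounded:
  assumes "norm a < 1" "norm z = 1"
  shows "norm (symbol_g a z) \<le> 1 + (1 - (norm a)\<^sup>2) / (1 - norm a)\<^sup>2"
  unfolding symbol_g_eq using norm_triangle_ineq[of 1 "poisson a z"] poisson_bounded[OF assms] by simp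

text \<open>An explicit spectral (Fejer--Riesz) factorization. Over the common denominator
  \<open>\<bar>1 - cnj a * z\<bar>\<^sup>2\<close>, the symbol has the numerator \<open>2 - cnj a * z - a * cnj z\<close> on the circle. It is \<open>\<bar>c - d z\<bar>\<^sup>2\<close> as soon as \<open>c\<^sup>2 + \<bar>d\<bar>\<^sup>2 = 2\<close> and \<open>c * d = cnj a\<close>; the solution with
  \<open>\<bar>d\<bar> < c\<close>, so that \<open>c - d z\<close> has no zero in the closed disk, is \<open>c\<^sup>2 = 1 + s\<close>, \<open>\<bar>d\<bar>\<^sup>2 = 1 - s\<close>, where
  \<open>s = sqrt (1 - \<bar>a\<bar>\<^sup>2)\<close>.\<close>
lemma symbol_g_factorization:
  assumes a: "norm a < 1"
  obtains q r where "q \<in> disk_algebra" "r \<in> disk_algebra" "\<And>z. norm z = 1 \<Longrightarrow> r z * q z = 1"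
    "\<And>z. norm z = 1 \<Longrightarrow> symbol_g a z = q z * cnj (q z)"
proof -
  define s where "s = sqrt (1 - (norm a)\<^sup>2)"
  have a2: "(norm a)\<^sup>2 \<le> 1" using a by (simp add: power_le_one)
  then have s: "s \<ge> 0" "s\<^sup>2 = 1 - (norm a)\<^sup>2" by (auto simp: s_def)
  define c where "c = sqrt (1 + s)"
  have c: "c \<ge> 1" "c\<^sup>2 = 1 + s" using s by (auto simp: c_def)
  define d where "d = cnj a / of_real c"
  have cd: "of_real c * d = cnj a" using c by (simp add: d_def)
  have d2: "(norm d)\<^sup>2 = 1 - s"
  proof -
    have "(norm d)\<^sup>2 = (norm a)\<^sup>2 / (1 + s)" by (simp add: d_def norm_divide power_divide c)
    also have "(norm a)\<^sup>2 = (1 - s) * (1 + s)" using s by (simp add: algebra_simps power2_eq_square)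
    finally show ?thesis using s by simp
  qed
  have d1: "norm d < c"
  proof -
    have "norm d \<le> norm a" using c by (simp add: d_def norm_divide divide_le_eq mult_left_le_one_le mult_le_cancel_left1)
    then show ?thesis using a c by linarith
  qed
  have nz: "of_real c - d * z \<noteq> 0" if "norm z \<le> 1" for z
  proof
    assume "of_real c - d * z = 0"
    then have "of_real c = d * z" by simp
    then have "norm (complex_of_real c) = norm (d * z)" by (rule arg_cong)
    then have "c = norm d * norm z" using c by (simp add: norm_mult)
    also have "\<dots> \<le> norm d * 1" using that by (intro mult_left_mono) auto
    finally show False using d1 by simp
  qed
  let ?q = "\<lambda>z. (of_real c - d * z) / (1 - cnj a * z)"
  let ?r = "\<lambda>z. (1 - cnj a * z) / (of_real c - d * z)"
  show ?thesis
  proof (rule that[of ?q ?r])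
    show "?q \<in> disk_algebra" "?r \<in> disk_algebra"
      by (intro disk_algebra_divide disk_algebra_affine nz one_minus_cnj_mult_nz[OF a]; assumption)+
    fix z :: complex assume z: "norm z = 1"
    show "?r z * ?q z = 1" using nz[of z] one_minus_cnj_mult_nz[OF a, of z] z by simp
    have zz: "z * cnj z = 1" using z by (simp add: complex_norm_square[symmetric])
    have dd: "d * cnj d = 1 - of_real s"
      using d2 complex_norm_square[of d] by (metis of_real_1 of_real_diff)
    have cc: "of_real c * of_real c = (1 + of_real s :: complex)"
      using c(2) by (metis of_real_1 of_real_add of_real_mult power2_eq_square)
    have cd': "of_real c * cnj d = a" using arg_cong[OF cd, of cnj] by simp
    have "(of_real c - d * z) * cnj (of_real c - d * z)
        = of_real c * of_real c + (d * cnj d) * (z * cnj z) - (of_real c * d) * z - (of_real c * cnj d) * cnj z"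
      by (simp add: algebra_simps)
    also have "\<dots> = 2 - cnj a * z - a * cnj z" unfolding cd cd' dd cc zz by simp
    also have "\<dots> = (1 - cnj a * z) * cnj (1 - cnj a * z) + (1 - a * cnj a)"
      using zz by simp algebra
    finally have num: "(of_real c - d * z) * cnj (of_real c - d * z)
        = (1 - cnj a * z) * cnj (1 - cnj a * z) + (1 - a * cnj a)" .
    have nz1: "(1 - cnj a * z) * cnj (1 - cnj a * z) \<noteq> 0"
      using one_minus_cnj_mult_nz[OF a, of z] z by (simp only: mult_eq_0_iff complex_cnj_zero_iff) simp
    have "?q z * cnj (?q z) = ((of_real c - d * z) * cnj (of_real c - d * z)) / ((1 - cnj a * z) * cnj (1 - cnj a * z))"
      by simp
    also have "\<dots> = 1 + (1 - a * cnj a) / ((1 - cnj a * z) * cnj (1 - cnj a * z))"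
      unfolding num add_divide_distrib divide_self[OF nz1] ..
    also have "\<dots> = symbol_g a z"
      unfolding symbol_g_eq poisson_def of_real_divide of_real_diff of_real_1 complex_norm_square ..
    finally show "symbol_g a z = ?q z * cnj (?q z)" ..
  qed
qed

text \<open>In operator terms, \<open>T = I + C\<^sub>a\<^sup>* C\<^sub>a\<close> for the Toeplitz operator \<open>T\<close> with symbol \<open>g\<^sub>a\<close>.\<close>
lemma toeplitz_symbol_g_inner:
  assumes a: "norm a < 1" and f: "f \<in> hardy2" and k: "k \<in> hardy2"
  shows "hardy_inner (toeplitz (symbol_g a) f) k
    = hardy_inner f k + hardy_inner (comp_op a f) (comp_op a k)"
proof -
  note tf = trace_boundary[OF f] and tk = trace_boundary[OF k]
  have "hardy_inner (toeplitz (symbol_g a) f) k = L2_inner (\<lambda>z. symbol_g a z * boundary f z) (boundary k)"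
    by (rule toeplitz_inner[OF symbol_g_measurable symbol_g_bounded[OF a] tf tk])
  also have "\<dots> = L2_inner (boundary f) (boundary k) + L2_inner (\<lambda>z. poisson a z * boundary f z) (boundary k)"
    by (simp add: symbol_g_eq ring_distribs L2_inner_add_left trace_L2[OF tf] trace_L2[OF tk] L2_poisson_mult[OF a])
  finally show ?thesis by (simp add: trace_inner[OF tf tk] comp_op_inner[OF a tf tk])
qed

text \<open>With \<open>g\<^sub>a = q * cnj q\<close> on the circle and \<open>r = 1/q\<close>, the preimage of \<open>f\<close> is
  \<open>u = r * h\<close>, where \<open>h\<close> is the projection of \<open>cnj r * F\<close>. Indeed, in
  \<open>\<langle>g\<^sub>a r H, K\<rangle> = \<langle>H, q K\<rangle>\<close> the second entry is again the boundary function of an element of the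
  Hardy space, so \<open>H\<close> may be replaced by \<open>cnj r * F\<close>, and \<open>\<langle>cnj r * F, q K\<rangle> = \<langle>F, K\<rangle>\<close>.\<close>
lemma toeplitz_symbol_g_surj:
  assumes a: "norm a < 1" and f: "f \<in> hardy2"
  obtains u where "u \<in> hardy2" "toeplitz (symbol_g a) u = f"
proof -
  obtain q r where q: "q \<in> disk_algebra" and r: "r \<in> disk_algebra"
    and rq: "\<And>z. norm z = 1 \<Longrightarrow> r z * q z = 1"
    and g: "\<And>z. norm z = 1 \<Longrightarrow> symbol_g a z = q z * cnj (q z)"
    using symbol_g_factorization[OF a] by metis
  note tf = trace_boundary[OF f]
  define F where "F = boundary f"
  have F: "has_trace f F" unfolding F_def by (rule tf)
  obtain R where R: "\<And>z. norm z \<le> 1 \<Longrightarrow> norm (r z) \<le> R" using disk_algebra_bounded[OF r] by blast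
  have [measurable]: "r \<in> borel_measurable borel" using r by (simp add: disk_algebra_def)
  have G: "(\<lambda>z. cnj (r z) * F z) \<in> L2_circle"
    by (rule L2_mult_bounded(1)[of _ F R]) (auto intro: R trace_L2[OF F])
  define h where "h = szego_proj (\<lambda>z. cnj (r z) * F z)"
  have h: "h \<in> hardy2" unfolding h_def by (rule szego_proj_hardy[OF G])
  obtain H where H: "has_trace h H" using trace_exists[OF h] .
  define u where "u z = r z * h z" for z
  have U: "has_trace u (\<lambda>z. r z * H z)" unfolding u_def[abs_def] by (rule trace_mult[OF H r])
  have uh: "u \<in> hardy2" by (rule trace_hardy[OF U])
  have "toeplitz (symbol_g a) u = f"
  proof (rule hardy_inner_extensional)
    show "toeplitz (symbol_g a) u \<in> hardy2"
      by (rule toeplitz_hardy[OF symbol_g_measurable symbol_g_bounded[OF a] uh])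
    show "f \<in> hardy2" by (rule f)
    fix k assume k: "k \<in> hardy2"
    obtain K where K: "has_trace k K" using trace_exists[OF k] .
    have qK: "has_trace (\<lambda>z. q z * k z) (\<lambda>z. q z * K z)" by (rule trace_mult[OF K q])
    have "hardy_inner (toeplitz (symbol_g a) u) k = L2_inner (\<lambda>z. symbol_g a z * (r z * H z)) K"
      by (rule toeplitz_inner[OF symbol_g_measurable symbol_g_bounded[OF a] U K])
    also have "\<dots> = L2_inner H (\<lambda>z. q z * K z)"
    proof (rule L2_inner_cong_AE)
      show "AE z in circle_measure. symbol_g a z * (r z * H z) * cnj (K z) = H z * cnj (q z * K z)"
        using AE_circle_measure
      proof eventually_elim
        case (elim z)
        have "symbol_g a z * (r z * H z) * cnj (K z) = (r z * q z) * (H z * (cnj (q z) * cnj (K z)))"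
          unfolding g[OF elim] by (simp add: mult_ac)
        then show ?case by (simp add: rq[OF elim])
      qed
    qed (intro trace_L2[OF H] trace_L2[OF K] trace_L2[OF qK] trace_L2[OF U]
          L2_mult_bounded(1)[OF symbol_g_measurable _ symbol_g_bounded[OF a]]; assumption)+
    also have "\<dots> = hardy_inner h (\<lambda>z. q z * k z)" by (rule trace_inner[OF H qK, symmetric])
    also have "\<dots> = L2_inner (\<lambda>z. cnj (r z) * F z) (\<lambda>z. q z * K z)"
      unfolding h_def by (rule szego_proj_inner[OF G qK])
    also have "\<dots> = L2_inner F K"
    proof (rule L2_inner_cong_AE)
      show "AE z in circle_measure. cnj (r z) * F z * cnj (q z * K z) = F z * cnj (K z)"
        using AE_circle_measure
      proof eventually_elim
        case (elim z)
        have "cnj (r z) * F z * cnj (q z * K z) = cnj (r z * q z) * (F z * cnj (K z))"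
          by (simp add: mult_ac)
        then show ?case by (simp add: rq[OF elim])
      qed
    qed (intro G trace_L2[OF F] trace_L2[OF K] trace_L2[OF qK])+
    also have "\<dots> = hardy_inner f k" by (rule trace_inner[OF F K, symmetric])
    finally show "hardy_inner (toeplitz (symbol_g a) u) k = hardy_inner f k" .
  qed
  with uh show ?thesis by (rule that)
qed

text \<open>\<open>\<langle>T u, u\<rangle> = \<parallel>u\<parallel>\<^sup>2 + \<parallel>C\<^sub>a u\<parallel>\<^sup>2 \<ge> \<parallel>u\<parallel>\<^sup>2\<close>, and the Cauchy--Schwarz inequality.\<close>
lemma toeplitz_symbol_g_expansive:
  assumes a: "norm a < 1" and u: "u \<in> hardy2"
  shows "hardy_norm u \<le> hardy_norm (toeplitz (symbol_g a) u)"
proof -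
  let ?T = "toeplitz (symbol_g a)"
  have T: "?T u \<in> hardy2" by (rule toeplitz_hardy[OF symbol_g_measurable symbol_g_bounded[OF a] u])
  have "hardy_inner (?T u) u = of_real ((hardy_norm u)\<^sup>2 + (hardy_norm (comp_op a u))\<^sup>2)"
    using a u by (simp add: toeplitz_symbol_g_inner hardy_inner_self comp_op_hardy)
  then have "norm (hardy_inner (?T u) u) = (hardy_norm u)\<^sup>2 + (hardy_norm (comp_op a u))\<^sup>2"
    by (simp only: norm_of_real) simp
  then have "(hardy_norm u)\<^sup>2 \<le> hardy_norm (?T u) * hardy_norm u"
    using hardy_Cauchy_Schwarz[OF T u] zero_le_power2[of "hardy_norm (comp_op a u)"] by linarith
  then show ?thesis
    using hardy_norm_nonneg[OF u] hardy_norm_nonneg[OF T] 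
    by (cases "hardy_norm u = 0") (auto simp: power2_eq_square)
qed

section \<open>Inversion and orthogonal projection\<close>

lemma bounded_opD:
  assumes "bounded_op T" "f \<in> hardy2"
  shows bounded_op_hardy: "T f \<in> hardy2"
    and bounded_op_scale: "T (\<lambda>z. c * f z) = (\<lambda>z. c * T f z)"
    and bounded_op_add: "g \<in> hardy2 \<Longrightarrow> T (\<lambda>z. f z + g z) = (\<lambda>z. T f z + T g z)"
  using assms unfolding bounded_op_def by blast+

lemma bounded_op_diff:
  assumes T: "bounded_op T" and f: "f \<in> hardy2" and g: "g \<in> hardy2"
  shows "T (\<lambda>z. f z - g z) = (\<lambda>z. T f z - T g z)"
  using bounded_op_add[OF T f hardy_scale(1)[OF g, of "-1"]] bounded_op_scale[OF T g, of "-1"] by simp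

lemma invertible_opI:
  assumes T: "bounded_op T" and surj: "\<And>f. f \<in> hardy2 \<Longrightarrow> \<exists>u\<in>hardy2. T u = f"
    and exp: "\<And>u. u \<in> hardy2 \<Longrightarrow> hardy_norm u \<le> hardy_norm (T u)"
  shows "invertible_op T" and "inj_on T hardy2"
proof -
  show inj: "inj_on T hardy2"
  proof (rule inj_onI)
    fix u v assume u: "u \<in> hardy2" and v: "v \<in> hardy2" and eq: "T u = T v"
    let ?d = "\<lambda>z. u z - v z"
    have d: "?d \<in> hardy2" by (rule hardy_diff(1)[OF u v])
    have "T ?d = (\<lambda>z. 0)" by (simp add: bounded_op_diff[OF T u v] eq)
    then have "hardy_norm ?d \<le> hardy_norm (\<lambda>z. 0)" using exp[OF d] by simp
    also have "hardy_norm (\<lambda>z. 0) = 0"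
      using hardy_inner_self[OF hardy_zero] hardy_inner_scale_left[OF hardy_zero hardy_zero, of 0] by simp
    finally have "hardy_norm ?d = 0" using hardy_norm_nonneg[OF d] by simp
    from hardy_norm_eq_0[OF d this] show "u = v" by (auto simp: fun_eq_iff)
  qed
  define S where "S = the_inv_into hardy2 T"
  have img: "T ` hardy2 = hardy2"
    using bounded_op_hardy[OF T] surj by blast
  have S: "S f \<in> hardy2" "T (S f) = f" if "f \<in> hardy2" for f
    using the_inv_into_into[OF inj, of f hardy2] f_the_inv_into_f[OF inj, of f] that img by (auto simp: S_def)
  have ST: "S (T f) = f" if "f \<in> hardy2" for f
    unfolding S_def by (rule the_inv_into_f_f[OF inj that])
  have "bounded_op S"
    unfolding bounded_op_def
  proof (intro conjI ballI allI)
    fix f g c assume f: "f \<in> hardy2" and g: "g \<in> hardy2"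
    show "S f \<in> hardy2" by (rule S(1)[OF f])
    have "T (\<lambda>z. S f z + S g z) = (\<lambda>z. f z + g z)"
      using bounded_op_add[OF T S(1)[OF f] S(1)[OF g]] by (simp add: S(2) f g)
    then show "S (\<lambda>z. f z + g z) = (\<lambda>z. S f z + S g z)"
      using ST[OF hardy_add(1)[OF S(1)[OF f] S(1)[OF g]]] by simp
    have "T (\<lambda>z. c * S f z) = (\<lambda>z. c * f z)"
      using bounded_op_scale[OF T S(1)[OF f]] by (simp add: S(2) f)
    then show "S (\<lambda>z. c * f z) = (\<lambda>z. c * S f z)"
      using ST[OF hardy_scale(1)[OF S(1)[OF f], of c]] by simp
  next
    have "hardy_norm (S f) \<le> 1 * hardy_norm f" if "f \<in> hardy2" for f
      using exp[OF S(1)[OF that]] S(2)[OF that] by simp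
    then show "\<exists>K. \<forall>f\<in>hardy2. hardy_norm (S f) \<le> K * hardy_norm f" by blast
  qed
  then show "invertible_op T"
    using T S(2) ST unfolding invertible_op_def by blast
qed

lemma orth_proj_eqI:
  assumes f: "f \<in> hardy2" and sub: "S \<subseteq> hardy2"
    and diff: "\<And>g h. g \<in> S \<Longrightarrow> h \<in> S \<Longrightarrow> (\<lambda>z. g z - h z) \<in> S"
    and g: "g \<in> S" and orth: "\<And>h. h \<in> S \<Longrightarrow> hardy_inner (\<lambda>z. f z - g z) h = 0"
  shows "orth_proj S f = g"
  unfolding orth_proj_def
proof (rule the_equality)
  show "g \<in> S \<and> (\<forall>h\<in>S. hardy_inner (\<lambda>z. f z - g z) h = 0)" using g orth by blast
  fix p assume p: "p \<in> S \<and> (\<forall>h\<in>S. hardy_inner (\<lambda>z. f z - p z) h = 0)"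
  let ?d = "\<lambda>z. p z - g z"
  have d: "?d \<in> S" using diff p g by blast
  have H: "p \<in> hardy2" "g \<in> hardy2" "?d \<in> hardy2" using p g d sub by auto
  have "hardy_inner (\<lambda>z. f z - p z) ?d = 0" using p d by blast
  then have "hardy_inner f ?d = hardy_inner p ?d" by (simp add: hardy_inner_diff_left f H)
  moreover have "hardy_inner f ?d = hardy_inner g ?d" using orth[OF d] by (simp add: hardy_inner_diff_left f H)
  ultimately have "hardy_inner ?d ?d = 0" by (simp add: hardy_inner_diff_left[of p g] H)
  then have "hardy_norm ?d = 0" by (simp add: hardy_inner_self H)
  from hardy_norm_eq_0[OF H(3) this] show "p = g" by (auto simp: fun_eq_iff)
qed

text \<open>The heart of the matter, for both signs \<open>e\<close> at once. Put \<open>f = T u = u + C\<^sup>* C u\<close>. As \<open>C\<close> is an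
  involution, \<open>u + e C u\<close> lies in the eigenspace \<open>C h = e h\<close>, and the defect
  \<open>f - (u + e C u) = C\<^sup>* C u - e C u\<close> is orthogonal to it, because
  \<open>\<langle>C\<^sup>* C u, h\<rangle> = \<langle>C u, C h\<rangle> = e \<langle>C u, h\<rangle>\<close>.\<close>
lemma orth_proj_comp_op_eigenspace:
  assumes a: "norm a < 1" and u: "u \<in> hardy2" and e: "e = 1 \<or> e = -1"
  shows "orth_proj {h \<in> hardy2. comp_op a h = (\<lambda>z. e * h z)} (toeplitz (symbol_g a) u)
    = (\<lambda>z. u z + e * comp_op a u z)"
proof (rule orth_proj_eqI)
  let ?C = "comp_op a"
  have ee: "e * e = 1" "cnj e = e" using e by auto
  have Cu: "?C u \<in> hardy2" by (rule comp_op_hardy[OF a u])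
  have T: "toeplitz (symbol_g a) u \<in> hardy2"
    by (rule toeplitz_hardy[OF symbol_g_measurable symbol_g_bounded[OF a] u])
  show "toeplitz (symbol_g a) u \<in> hardy2" by (rule T)
  show "{h \<in> hardy2. ?C h = (\<lambda>z. e * h z)} \<subseteq> hardy2" by auto
  have lin: "?C (\<lambda>z. g z - h z) = (\<lambda>z. ?C g z - ?C h z)" for g h by (auto simp: comp_op_def)
  show "(\<lambda>z. g z - h z) \<in> {h \<in> hardy2. ?C h = (\<lambda>z. e * h z)}"
    if "g \<in> {h \<in> hardy2. ?C h = (\<lambda>z. e * h z)}" "h \<in> {h \<in> hardy2. ?C h = (\<lambda>z. e * h z)}" for g h
    using that by (auto simp: lin hardy_diff ring_distribs)
  have p: "(\<lambda>z. u z + e * ?C u z) \<in> hardy2" by (intro hardy_add hardy_scale u Cu)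
  have "?C (\<lambda>z. u z + e * ?C u z) = (\<lambda>z. ?C u z + e * ?C (?C u) z)"
    by (auto simp: comp_op_def)
  also have "\<dots> = (\<lambda>z. e * (u z + e * ?C u z))"
    by (simp add: comp_op_comp_op[OF a u] ring_distribs mult.assoc[symmetric] ee add.commute)
  finally show "(\<lambda>z. u z + e * ?C u z) \<in> {h \<in> hardy2. ?C h = (\<lambda>z. e * h z)}"
    using p by simp
  fix h assume "h \<in> {h \<in> hardy2. ?C h = (\<lambda>z. e * h z)}"
  then have h: "h \<in> hardy2" and Ch: "?C h = (\<lambda>z. e * h z)" by auto
  show "hardy_inner (\<lambda>z. toeplitz (symbol_g a) u z - (u z + e * ?C u z)) h = 0"
    by (simp add: hardy_inner_diff_left T p h hardy_inner_add_left u hardy_scale Cu hardy_inner_scale_left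
      toeplitz_symbol_g_inner[OF a u h] Ch hardy_inner_scale_right ee)
qed

theorem corollary4p9:
  fixes a :: complex
  assumes "a \<in> ball 0 1"
  shows "invertible_op (toeplitz (symbol_g a)) \<and>
    (\<forall>f\<in>hardy2. refl_r (comp_op a) f =
       (\<lambda>z. 2 * (inverse_op (toeplitz (symbol_g a)) f z
                 + comp_op a (inverse_op (toeplitz (symbol_g a)) f) z) - f z)) \<and>
    (\<forall>f\<in>hardy2. refl_n (comp_op a) f =
       (\<lambda>z. 2 * (inverse_op (toeplitz (symbol_g a)) f z
                 - comp_op a (inverse_op (toeplitz (symbol_g a)) f) z) - f z))"
proof -
  have a: "norm a < 1" using assms by simp
  let ?T = "toeplitz (symbol_g a)"
  have T: "bounded_op ?T" by (rule toeplitz_bounded_op[OF symbol_g_measurable symbol_g_bounded[OF a]])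
  have surj: "\<exists>u\<in>hardy2. ?T u = f" if "f \<in> hardy2" for f
    using toeplitz_symbol_g_surj[OF a that] by blast
  note inv = invertible_opI[OF T surj toeplitz_symbol_g_expansive[OF a]]
  have null_r: "null_space (\<lambda>g z. comp_op a g z - g z) = {h \<in> hardy2. comp_op a h = (\<lambda>z. 1 * h z)}"
    by (auto simp: null_space_def fun_eq_iff)
  have null_n: "null_space (\<lambda>g z. comp_op a g z + g z) = {h \<in> hardy2. comp_op a h = (\<lambda>z. -1 * h z)}"
    by (auto simp: null_space_def fun_eq_iff eq_neg_iff_add_eq_0)
  have "refl_r (comp_op a) f = (\<lambda>z. 2 * (inverse_op ?T f z + comp_op a (inverse_op ?T f) z) - f z) \<and>
    refl_n (comp_op a) f = (\<lambda>z. 2 * (inverse_op ?T f z - comp_op a (inverse_op ?T f) z) - f z)"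
    if f: "f \<in> hardy2" for f
  proof -
    obtain u where u: "u \<in> hardy2" and Tu: "?T u = f" using surj[OF f] by blast
    have "inverse_op ?T f = u"
      unfolding inverse_op_def Tu[symmetric] by (rule the_inv_into_f_f[OF inv(2) u])
    then show ?thesis
      using orth_proj_comp_op_eigenspace[OF a u, of 1] orth_proj_comp_op_eigenspace[OF a u, of "-1"]
      by (simp add: refl_r_def refl_n_def null_r null_n Tu)
  qed
  then show ?thesis using inv(1) by blast
qed

end
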